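(* Let $n\ge1$ and $1<q<\infty$. For all real numbers $1<\alpha_0<\alpha$ we have $T^{1,q}_\alpha(\gamma)=T^{1,q}_{\alpha_0}(\gamma)$ with equivalent norms.
   Context: $\gamma$ is the standard Gaussian measure on $\mathbb{R}^n$, $d\gamma(x)=(2\pi)^{-n/2}\exp(-\frac12|x|^2)\,dx$. $B(x,r)=\{y\in\mathbb{R}^n:|x-y|<r\}$ and $m(x)=\min\{1,1/|x|\}$ (with $m(0)=1$). Let $D=\{(x,t)\in\mathbb{R}^n\times(0,\infty): t<m(x)\}$. For $\alpha>0$, the Gaussian tent space $T^{1,q}_\alpha(\gamma)$ with aperture $\alpha$ is the completion of $C_{\rm c}(D)$ with respect to the norm $$\|f\|_{T^{1,q}_\alpha(\gamma)}=\|J_\alpha f\|_{L^1(\mathbb{R}^n,d\gamma(x);L^q(D,d\gamma(y)\frac{dt}{t}))},\qquad J_\alpha f(x,y,t)=\frac{\mathbf 1_{B(y,\alpha t)}(x)}{\gamma(B(y,t))^{1/q}}f(y,t),\quad f\in C_{\rm c}(D),$$ that is, $\|f\|_{T^{1,q}_\alpha(\gamma)}=\int_{\mathbb{R}^n}\big(\iint_D\frac{\mathbf 1_{B(y,\alpha t)}(x)}{\gamma(B(y,t))}|f(y,t)|^q\,d\gamma(y)\frac{dt}{t}\big)^{1/q}d\gamma(x)$. *)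

theory Defs
  imports "HOL-Analysis.Analysis"
begin

text \<open>
  \<open>\<real>\<^sup>n\<close> is an arbitrary type \<open>'a\<close> of class \<open>euclidean_space\<close>, so \<open>n = DIM('a) \<ge> 1\<close>. The scalar
  field is a type \<open>'b\<close> of class \<open>real_normed_field\<close>, which covers both real- and complex-valued
  functions.
\<close>

definition gauss_measure :: "'a::euclidean_space measure" where
  "gauss_measure = density lborel
     (\<lambda>x. ennreal ((2 * pi) powr (- real DIM('a) / 2) * exp (- (norm x)\<^sup>2 / 2)))"

text \<open>The case distinction is needed because \<open>1 / 0 = 0\<close>.\<close>

definition adm_radius :: "'a::euclidean_space \<Rightarrow> real" where
  "adm_radius x = (if x = 0 then 1 else min 1 (1 / norm x))"

definition gauss_D :: "('a::euclidean_space \<times> real) set" where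
  "gauss_D = {(x, t). 0 < t \<and> t < adm_radius x}"

definition haar_measure :: "real measure" where
  "haar_measure = density lborel (\<lambda>t. ennreal (indicator {0<..} t / t))"

definition upper_measure :: "('a::euclidean_space \<times> real) measure" where
  "upper_measure = gauss_measure \<Otimes>\<^sub>M haar_measure"

text \<open>
  Functions on the open set \<open>gauss_D\<close> with compact support inside \<open>gauss_D\<close>, represented by
  their extension by zero to the whole of \<open>'a \<times> real\<close>.
\<close>

definition Cc_D :: "('a::euclidean_space \<times> real \<Rightarrow> 'b::real_normed_field) set" where
  "Cc_D = {f. continuous_on gauss_D f \<and>
              compact (closure {p. f p \<noteq> 0}) \<and> closure {p. f p \<noteq> 0} \<subseteq> gauss_D}"

definition tent_J ::
  "real \<Rightarrow> real \<Rightarrow> ('a::euclidean_space \<times> real \<Rightarrow> 'b::real_normed_field) \<Rightarrow> 'a \<Rightarrow> 'a \<times> real \<Rightarrow> 'b"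
where
  "tent_J \<alpha> q f x = (\<lambda>(y, t).
     (indicator (ball y (\<alpha> * t)) x / measure gauss_measure (ball y t) powr (1 / q)) *\<^sub>R f (y, t))"

text \<open>
  The norm of \<open>L\<^sup>1(\<gamma>; L\<^sup>q(D))\<close> applied to \<open>tent_J \<alpha> q f\<close>. It is only used for \<open>f \<in> Cc_D\<close>: then
  \<open>tent_J \<alpha> q f\<close> is bounded and measurable, and it vanishes outside a set of pairs \<open>(x, (y, t))\<close>
  with \<open>x\<close> and \<open>y\<close> bounded and \<open>t\<close> bounded away from \<open>0\<close>. Both integrals are therefore finite, and
  the value \<open>0\<close> of the Bochner integral on non-integrable functions plays no role.
\<close>

definition tent_norm ::
  "real \<Rightarrow> real \<Rightarrow> ('a::euclidean_space \<times> real \<Rightarrow> 'b::real_normed_field) \<Rightarrow> real" where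
  "tent_norm \<alpha> q f =
     (\<integral>x. (LINT p:gauss_D|upper_measure. norm (tent_J \<alpha> q f x p) powr q) powr (1 / q)
        \<partial>gauss_measure)"

text \<open>
  The completion of a normed space is the set of equivalence classes of its Cauchy sequences, two
  sequences being equivalent if their difference tends to zero in norm. The vector space operations
  on the classes are the pointwise operations on representatives, and a vector of the original space
  is identified with the class of the corresponding constant sequence. Only the equivalence
  relation depends on the norm, so two norms on the same space whose completions are equal as sets
  of classes also have the same linear structure and the same embedding of the original space.
\<close>

definition cauchy_seqs :: "'v::minus set \<Rightarrow> ('v \<Rightarrow> real) \<Rightarrow> (nat \<Rightarrow> 'v) set" where
  "cauchy_seqs V N =
     {u. range u \<subseteq> V \<and> (\<forall>\<epsilon>>0. \<exists>M. \<forall>k\<ge>M. \<forall>l\<ge>M. N (u k - u l) < \<epsilon>)}"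

definition cauchy_equiv :: "'v::minus set \<Rightarrow> ('v \<Rightarrow> real) \<Rightarrow> ((nat \<Rightarrow> 'v) \<times> (nat \<Rightarrow> 'v)) set" where
  "cauchy_equiv V N =
     {(u, v). u \<in> cauchy_seqs V N \<and> v \<in> cauchy_seqs V N \<and> (\<lambda>k. N (u k - v k)) \<longlonglongrightarrow> 0}"

definition completion :: "'v::minus set \<Rightarrow> ('v \<Rightarrow> real) \<Rightarrow> (nat \<Rightarrow> 'v) set set" where
  "completion V N = cauchy_seqs V N // cauchy_equiv V N"

definition completion_norm :: "('v::minus \<Rightarrow> real) \<Rightarrow> (nat \<Rightarrow> 'v) set \<Rightarrow> real" where
  "completion_norm N F = (THE L. \<forall>u\<in>F. (\<lambda>k. N (u k)) \<longlonglongrightarrow> L)"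

definition tent_space ::
  "real \<Rightarrow> real \<Rightarrow> (nat \<Rightarrow> 'a::euclidean_space \<times> real \<Rightarrow> 'b::real_normed_field) set set" where
  "tent_space \<alpha> q = completion Cc_D (tent_norm \<alpha> q)"

definition tent_space_norm ::
  "real \<Rightarrow> real \<Rightarrow> (nat \<Rightarrow> 'a::euclidean_space \<times> real \<Rightarrow> 'b::real_normed_field) set \<Rightarrow> real" where
  "tent_space_norm \<alpha> q = completion_norm (tent_norm \<alpha> q)"

end

theory Submission
  imports Defs
begin

text \<open>
  Only the bound of the norm with the larger aperture by the norm with the smaller one needs an
  argument. For a fixed \<open>f\<close>, the density \<open>\<bar>f(y,t)\<bar>\<^sup>q / \<gamma>(B(y,t))\<close> with respect to \<open>d\<gamma>(y) dt/t\<close>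
  defines a finite measure \<open>\<mu>\<close> on \<open>D\<close>, and with the cone
  \<open>\<Gamma>\<^sub>a(x) = {(y,t) \<in> D. \<bar>x - y\<bar> < a t}\<close> the tent norm is \<open>\<integral> S\<^sub>a\<^sup>r d\<gamma>\<close>, where
  \<open>S\<^sub>a(x) = \<mu>(\<Gamma>\<^sub>a(x))\<close> and \<open>r = 1/q < 1\<close>. The comparison is then one between
  the measures of two cones: \<open>cone_change_of_aperture\<close> gives \<open>\<integral> S\<^sub>b\<^sup>r d\<gamma> \<le> C \<integral> S\<^sub>a\<^sup>r d\<gamma>\<close> for every finite measure \<open>\<mu>\<close>,
  all \<open>0 < a \<le> b\<close> and all \<open>0 < r < 1\<close>.

  The Gaussian measure is not doubling, but it is doubling on the balls \<open>B(y, c t)\<close> with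
  \<open>(y,t) \<in> D\<close>, because \<open>t < m(y)\<close> keeps the Gaussian density comparable to a constant on such a
  ball (\<open>gauss_doubling\<close>). Fix a level \<open>l > 0\<close>, put \<open>E = {S\<^sub>a > l}\<close>, and let the halo of \<open>E\<close> be the
  union of the balls \<open>B(y, b t)\<close> over those \<open>(y,t) \<in> D\<close> for which more than half of \<open>B(y, a t)\<close> lies
  in \<open>E\<close>. The halo has measure at most \<open>C \<gamma>(E)\<close>, by Vitali's covering lemma and doubling
  (\<open>emeasure_halo_le\<close>). A ball \<open>B(y, b t)\<close> that leaves the halo has at least half of \<open>B(y, a t)\<close>
  outside \<open>E\<close>, and therefore, by Fubini's theorem, the integral of \<open>S\<^sub>b\<close> outside the halo is at
  most \<open>C\<close> times the integral of \<open>S\<^sub>a\<close> outside \<open>E\<close>. Markov's inequality turns this into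
  \<open>\<gamma>{S\<^sub>b > l} \<le> C \<gamma>{S\<^sub>a > l} + (C/l) \<integral> S\<^sub>a 1{S\<^sub>a \<le> l} d\<gamma>\<close>
  (\<open>cone_distribution_bound\<close>). Multiplied by \<open>r l\<^sup>r\<^sup>-\<^sup>1\<close> and integrated over \<open>l > 0\<close>, the first term
  gives \<open>C \<integral> S\<^sub>a\<^sup>r d\<gamma>\<close>, and the second gives a multiple of the same integral, since
  \<open>\<integral> l\<^sup>r\<^sup>-\<^sup>2 dl\<close> converges at infinity for \<open>r < 1\<close>.

  The two norms are thus equivalent on \<open>C\<^sub>c(D)\<close>. They have the same Cauchy sequences and the same
  null sequences, which makes the completions equal as sets of classes. The triangle inequality for
  the tent norm, which rests on Minkowski's inequality, ensures that the norms converge along every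
  sequence of a class, and the inequalities between the norms pass to the limit.
\<close>

section \<open>The Gaussian measure at admissible scales\<close>

lemma sets_gauss_measure [simp, measurable_cong]: "sets gauss_measure = sets borel"
  by (simp add: gauss_measure_def)

lemma space_gauss_measure [simp]: "space gauss_measure = UNIV"
  by (simp add: gauss_measure_def)

lemma sets_haar_measure [simp, measurable_cong]: "sets haar_measure = sets borel"
  by (simp add: haar_measure_def)

lemma space_haar_measure [simp]: "space haar_measure = UNIV"
  by (simp add: haar_measure_def)

lemma sets_upper_measure [simp, measurable_cong]:
  "sets upper_measure = sets (borel :: ('a::euclidean_space \<times> real) measure)"
proof -
  have "sets upper_measure = sets ((borel :: 'a measure) \<Otimes>\<^sub>M (borel :: real measure))"
    unfolding upper_measure_def by (intro sets_pair_measure_cong) auto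
  then show ?thesis
    unfolding borel_prod .
qed

lemma space_upper_measure [simp]: "space upper_measure = UNIV"
  by (simp add: upper_measure_def space_pair_measure)

lemma sigma_finite_gauss_measure: "sigma_finite_measure gauss_measure"
  unfolding gauss_measure_def by (subst sigma_finite_measure.sigma_finite_iff_density_finite[OF lborel.sigma_finite_measure_axioms]) auto

lemma sigma_finite_haar_measure: "sigma_finite_measure haar_measure"
  unfolding haar_measure_def by (subst sigma_finite_measure.sigma_finite_iff_density_finite[OF lborel.sigma_finite_measure_axioms]) auto

interpretation gauss: sigma_finite_measure gauss_measure
  by (rule sigma_finite_gauss_measure)

interpretation haar: sigma_finite_measure haar_measure
  by (rule sigma_finite_haar_measure)

definition gauss_density :: "'a::euclidean_space \<Rightarrow> real" where
  "gauss_density x = (2 * pi) powr (- real DIM('a) / 2) * exp (- (norm x)\<^sup>2 / 2)"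

lemma gauss_density_pos: "0 < gauss_density x"
  by (simp add: gauss_density_def)

lemma gauss_density_measurable [measurable]: "gauss_density \<in> borel_measurable borel"
  unfolding gauss_density_def by measurable

lemma emeasure_gauss_measure:
  assumes "A \<in> sets borel"
  shows "emeasure gauss_measure A = (\<integral>\<^sup>+x. ennreal (gauss_density x) * indicator A x \<partial>lborel)"
  using assms by (simp add: gauss_measure_def emeasure_density gauss_density_def)

lemma adm_radius_eq: "adm_radius x = 1 / max 1 (norm x)"
  by (auto simp: adm_radius_def max_def min_def field_simps)

lemma mem_gauss_D_iff: "(y, t) \<in> gauss_D \<longleftrightarrow> 0 < t \<and> t < 1 \<and> t * norm y < 1"
proof (cases "norm y \<le> 1")
  case True
  then have "t * norm y \<le> t" if "0 < t"
    using that by (simp add: mult_left_le)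
  moreover have "(y, t) \<in> gauss_D \<longleftrightarrow> 0 < t \<and> t < 1"
    using True by (simp add: gauss_D_def adm_radius_eq max_absorb1)
  ultimately show ?thesis
    by (meson le_less_trans)
next
  case False
  then have "t \<le> t * norm y" if "0 < t"
    using that by simp
  moreover have "0 < norm y"
    using False by linarith
  then have "(y, t) \<in> gauss_D \<longleftrightarrow> 0 < t \<and> t * norm y < 1"
    using False by (simp add: gauss_D_def adm_radius_eq max_absorb2 pos_less_divide_eq)
  ultimately show ?thesis
    by (meson le_less_trans)
qed

lemma open_gauss_D: "open (gauss_D :: ('a::euclidean_space \<times> real) set)"
proof -
  have "gauss_D = {p :: 'a \<times> real. 0 < snd p} \<inter> {p. snd p < 1} \<inter> {p. snd p * norm (fst p) < 1}"
    by (simp add: set_eq_iff mem_gauss_D_iff split_paired_all)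
  also have "open \<dots>"
    by (intro open_Int open_Collect_less continuous_intros)
  finally show ?thesis .
qed

lemma gauss_D_borel [measurable]: "gauss_D \<in> sets borel"
  by (rule borel_open[OF open_gauss_D])

text \<open>
  On the ball \<open>B(y, \<rho> t)\<close> the exponent \<open>\<bar>x\<bar>\<^sup>2 / 2\<close> differs from \<open>\<bar>y\<bar>\<^sup>2 / 2\<close> by at most
  \<open>\<rho> t (\<rho> t + 2 \<bar>y\<bar>) / 2\<close>. For \<open>(y,t) \<in> D\<close> both \<open>t\<close> and \<open>t \<bar>y\<bar>\<close> are at most \<open>1\<close>, which bounds this
  by \<open>\<rho> (\<rho> + 2) / 2\<close>.
\<close>

lemma gauss_density_comparable:
  assumes yt: "(y, t) \<in> gauss_D" and x: "dist y x < \<rho> * t"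
  shows "gauss_density x \<le> exp (\<rho> * (\<rho> + 2) / 2) * gauss_density y"
    and "exp (- (\<rho> * (\<rho> + 2) / 2)) * gauss_density y \<le> gauss_density x"
proof -
  have t: "0 < t" "t < 1" "t * norm y < 1"
    using yt by (auto simp: mem_gauss_D_iff)
  have "0 < \<rho> * t"
    using x zero_le_dist[of y x] by linarith
  then have \<rho>: "0 < \<rho>"
    using t zero_less_mult_pos2 by blast
  have d: "\<bar>norm x - norm y\<bar> \<le> \<rho> * t"
    using x norm_triangle_ineq3[of x y] by (simp add: dist_norm norm_minus_commute)
  then have s: "norm x + norm y \<le> \<rho> * t + 2 * norm y"
    by linarith
  have "\<bar>(norm x)\<^sup>2 - (norm y)\<^sup>2\<bar> = \<bar>norm x - norm y\<bar> * (norm x + norm y)"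
    by (simp add: power2_eq_square square_diff_square_factored abs_mult mult.commute)
  also have "\<dots> \<le> (\<rho> * t) * (\<rho> * t + 2 * norm y)"
    using d s \<open>0 < \<rho> * t\<close> by (intro mult_mono) auto
  also have "\<dots> = \<rho> * (\<rho> * (t * t) + 2 * (t * norm y))"
    by (simp add: algebra_simps)
  also have "\<dots> \<le> \<rho> * (\<rho> * 1 + 2 * 1)"
    using \<rho> t mult_le_one[of t t] by (intro mult_left_mono add_mono) auto
  finally have *: "\<bar>(norm x)\<^sup>2 - (norm y)\<^sup>2\<bar> \<le> \<rho> * (\<rho> + 2)"
    by simp
  have "exp (- (norm x)\<^sup>2 / 2) \<le> exp (\<rho> * (\<rho> + 2) / 2 + - (norm y)\<^sup>2 / 2)"
    using * by simp
  then show "gauss_density x \<le> exp (\<rho> * (\<rho> + 2) / 2) * gauss_density y"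
    unfolding exp_add by (simp add: gauss_density_def mult_left_mono ac_simps)
  have "exp (- (\<rho> * (\<rho> + 2) / 2) + - (norm y)\<^sup>2 / 2) \<le> exp (- (norm x)\<^sup>2 / 2)"
    using * by simp
  then show "exp (- (\<rho> * (\<rho> + 2) / 2)) * gauss_density y \<le> gauss_density x"
    unfolding exp_add by (simp add: gauss_density_def mult_left_mono ac_simps)
qed

lemma emeasure_gauss_ball_le:
  fixes y :: "'a::euclidean_space"
  assumes yt: "(y, t) \<in> gauss_D"
  shows "emeasure gauss_measure (ball y (\<rho> * t))
         \<le> ennreal (exp (\<rho> * (\<rho> + 2) / 2) * gauss_density y) * emeasure lborel (ball y (\<rho> * t))"
proof -
  have "emeasure gauss_measure (ball y (\<rho> * t))
      \<le> (\<integral>\<^sup>+x. ennreal (exp (\<rho> * (\<rho> + 2) / 2) * gauss_density y) * indicator (ball y (\<rho> * t)) x \<partial>lborel)"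
    by (subst emeasure_gauss_measure)
       (auto intro!: nn_integral_mono ennreal_leI gauss_density_comparable[OF yt]
             split: split_indicator)
  then show ?thesis
    by (subst (asm) nn_integral_cmult_indicator) auto
qed

lemma emeasure_gauss_ball_ge:
  fixes y :: "'a::euclidean_space"
  assumes yt: "(y, t) \<in> gauss_D"
  shows "ennreal (exp (- (\<rho> * (\<rho> + 2) / 2)) * gauss_density y) * emeasure lborel (ball y (\<rho> * t))
         \<le> emeasure gauss_measure (ball y (\<rho> * t))"
proof -
  have "(\<integral>\<^sup>+x. ennreal (exp (- (\<rho> * (\<rho> + 2) / 2)) * gauss_density y) * indicator (ball y (\<rho> * t)) x \<partial>lborel)
      \<le> emeasure gauss_measure (ball y (\<rho> * t))"
    by (subst emeasure_gauss_measure)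
       (auto intro!: nn_integral_mono ennreal_leI gauss_density_comparable[OF yt]
             split: split_indicator)
  then show ?thesis
    by (subst (asm) nn_integral_cmult_indicator) auto
qed

text \<open>
  On both balls the Gaussian measure is Lebesgue measure times the density at the centre, up to a
  constant factor, so their measures compare as their volumes do.
\<close>

lemma gauss_doubling:
  assumes a: "0 < a" and b: "0 < b"
  obtains C where "0 < C"
    "\<And>(y :: 'a::euclidean_space) t. (y, t) \<in> gauss_D \<Longrightarrow>
       emeasure gauss_measure (ball y (b * t)) \<le> ennreal C * emeasure gauss_measure (ball y (a * t))"
proof
  define A where "A = a * (a + 2) / 2"
  define B where "B = b * (b + 2) / 2"
  define n where "n = DIM('a)"
  define C where "C = exp (B + A) * (b / a) ^ n"
  show "0 < C"
    using a b by (simp add: C_def)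
  fix y :: 'a and t assume yt: "(y, t) \<in> gauss_D"
  then have t: "0 < t"
    by (simp add: mem_gauss_D_iff)
  have "exp (B + A) * exp (- A) = exp B"
    by (simp flip: exp_add)
  moreover have "(b / a) ^ n * (a * t) ^ n = (b * t) ^ n"
    using a by (simp flip: power_mult_distrib)
  moreover have "C * (exp (- A) * gauss_density y * (unit_ball_vol (real n) * (a * t) ^ n))
      = (exp (B + A) * exp (- A)) * gauss_density y * (unit_ball_vol (real n) * ((b / a) ^ n * (a * t) ^ n))"
    unfolding C_def by (simp only: mult.assoc mult.commute mult.left_commute)
  ultimately have eq: "C * (exp (- A) * gauss_density y * (unit_ball_vol (real n) * (a * t) ^ n))
      = exp B * gauss_density y * (unit_ball_vol (real n) * (b * t) ^ n)"
    by simp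
  have "emeasure gauss_measure (ball y (b * t))
      \<le> ennreal (exp B * gauss_density y) * ennreal (unit_ball_vol (real n) * (b * t) ^ n)"
    using emeasure_gauss_ball_le[OF yt, of b] t b by (simp add: emeasure_ball n_def B_def)
  also have "\<dots> = ennreal (C * (exp (- A) * gauss_density y * (unit_ball_vol (real n) * (a * t) ^ n)))"
    using b t gauss_density_pos[of y] unfolding eq by (subst ennreal_mult[symmetric]) auto
  also have "\<dots> = ennreal C * (ennreal (exp (- A) * gauss_density y) * ennreal (unit_ball_vol (real n) * (a * t) ^ n))"
    using a b t gauss_density_pos[of y] \<open>0 < C\<close> by (simp add: ennreal_mult)
  also have "\<dots> \<le> ennreal C * emeasure gauss_measure (ball y (a * t))"
    using emeasure_gauss_ball_ge[OF yt, of a] t a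
    by (intro mult_left_mono) (simp_all add: emeasure_ball n_def A_def)
  finally show "emeasure gauss_measure (ball y (b * t)) \<le> ennreal C * emeasure gauss_measure (ball y (a * t))" .
qed

lemma emeasure_gauss_bounded:
  assumes "A \<in> sets borel" "bounded (A :: 'a::euclidean_space set)"
  shows "emeasure gauss_measure A < \<infinity>"
proof -
  have "emeasure gauss_measure A
      \<le> (\<integral>\<^sup>+x. ennreal ((2 * pi) powr (- real DIM('a) / 2)) * indicator A x \<partial>lborel)"
    using assms unfolding emeasure_gauss_measure[OF assms(1)]
    by (auto intro!: nn_integral_mono ennreal_leI simp: gauss_density_def mult_le_cancel_left2 split: split_indicator)
  also have "\<dots> = ennreal ((2 * pi) powr (- real DIM('a) / 2)) * emeasure lborel A"
    using assms by (intro nn_integral_cmult_indicator) auto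
  also have "\<dots> < \<infinity>"
    using emeasure_bounded_finite[OF assms(2)] by (simp add: ennreal_mult_less_top)
  finally show ?thesis .
qed

lemma measure_gauss_ball_pos:
  fixes y :: "'a::euclidean_space"
  assumes yt: "(y, t) \<in> gauss_D" 
  shows "0 < measure gauss_measure (ball y t)"
proof -
  have t: "0 < t"
    using yt by (simp add: mem_gauss_D_iff)
  have "0 < ennreal (exp (- (1 * (1 + 2) / 2)) * gauss_density y) * emeasure lborel (ball y (1 * t))"
    using t gauss_density_pos[of y]
    by (simp add: emeasure_ball ennreal_zero_less_mult_iff)
  also have "\<dots> \<le> emeasure gauss_measure (ball y (1 * t))"
    by (rule emeasure_gauss_ball_ge[OF yt])
  finally show ?thesis
    using emeasure_gauss_bounded[of "ball y t"] by (simp add: measure_def enn2real_positive_iff)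
qed

lemma emeasure_gauss_ball_measurable [measurable]:
  assumes [measurable]: "A \<in> sets borel"
  shows "(\<lambda>p :: 'a::euclidean_space \<times> real. emeasure gauss_measure (ball (fst p) (a * snd p) \<inter> A))
    \<in> borel_measurable borel"
proof -
  have [measurable]: "fst \<in> borel_measurable (borel :: ('a \<times> real) measure)"
    "snd \<in> borel_measurable (borel :: ('a \<times> real) measure)"
    by (auto intro!: borel_measurable_continuous_onI continuous_intros)
  have "(\<lambda>(p, x). if dist (fst p) x < a * snd p then indicator A x else 0 :: ennreal)
      \<in> borel_measurable ((borel :: ('a \<times> real) measure) \<Otimes>\<^sub>M gauss_measure)"
    by measurable
  from gauss.borel_measurable_nn_integral[OF this]
  have "(\<lambda>p :: 'a \<times> real. \<integral>\<^sup>+x. (if dist (fst p) x < a * snd p then indicator A x else 0) \<partial>gauss_measure)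
      \<in> borel_measurable borel" .
  also have "(\<lambda>p :: 'a \<times> real. \<integral>\<^sup>+x. (if dist (fst p) x < a * snd p then indicator A x else 0) \<partial>gauss_measure)
      = (\<lambda>p. \<integral>\<^sup>+x. indicator (ball (fst p) (a * snd p) \<inter> A) x \<partial>gauss_measure)"
    by (intro ext nn_integral_cong) (auto split: split_indicator)
  finally show ?thesis
    by simp
qed

section \<open>Cones, half-full balls and halos\<close>

definition gauss_cone :: "real \<Rightarrow> 'a::euclidean_space \<Rightarrow> ('a \<times> real) set" where
  "gauss_cone a x = {(y, t). (y, t) \<in> gauss_D \<and> x \<in> ball y (a * t)}"

definition half_full :: "real \<Rightarrow> 'a::euclidean_space set \<Rightarrow> ('a \<times> real) set" where
  "half_full a E = {(y, t) \<in> gauss_D.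
     emeasure gauss_measure (ball y (a * t)) < 2 * emeasure gauss_measure (ball y (a * t) \<inter> E)}"

definition halo :: "real \<Rightarrow> real \<Rightarrow> 'a::euclidean_space set \<Rightarrow> 'a set" where
  "halo a b E = (\<Union>(y, t) \<in> half_full a E. ball y (b * t))"

lemma halo_borel [measurable]: "halo a b E \<in> sets borel"
  by (intro borel_open) (auto simp: halo_def)

text \<open>
  This replaces the weak type estimate for a maximal function. Vitali's lemma selects
  disjoint balls \<open>B(y, b t)\<close> from the family that defines the halo, such that the balls of five times
  the radius cover it. Doubling bounds the measure of each enlarged ball by that of \<open>B(y, a t)\<close>, more
  than half of which lies in \<open>E\<close>, and these parts of \<open>E\<close> are disjoint because \<open>a \<le> b\<close>.
\<close>

lemma emeasure_halo_le:
  assumes a: "0 < a" and ab: "a \<le> b"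
  obtains C where "0 < C"
    "\<And>E :: 'a::euclidean_space set. E \<in> sets borel \<Longrightarrow>
       emeasure gauss_measure (halo a b E) \<le> ennreal C * emeasure gauss_measure E"
proof -
  obtain C where C: "0 < C"
    and dbl: "\<And>(y :: 'a) t. (y, t) \<in> gauss_D \<Longrightarrow>
      emeasure gauss_measure (ball y (5 * b * t)) \<le> ennreal C * emeasure gauss_measure (ball y (a * t))"
    using gauss_doubling[of a "5 * b"] a ab by auto
  have "emeasure gauss_measure (halo a b E) \<le> ennreal (C * 2) * emeasure gauss_measure E"
    if E [measurable]: "E \<in> sets borel" for E :: "'a set"
  proof -
    \<comment> \<open>Vitali's lemma needs bounded radii, and \<open>t < 1\<close> on \<open>D\<close>.\<close>
    have "0 < b * snd p \<and> b * snd p \<le> b" if "p \<in> half_full a E" for p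
      using that a ab by (auto simp: half_full_def mem_gauss_D_iff mult_left_le)
    from Vitali_covering_lemma_cballs_balls[of "half_full a E" "\<lambda>p. b * snd p" b fst, OF this]
    obtain S where S: "countable S" "S \<subseteq> half_full a E"
      and disj: "pairwise (\<lambda>i j. disjnt (cball (fst i) (b * snd i)) (cball (fst j) (b * snd j))) S"
      and cover: "\<And>i. i \<in> half_full a E \<Longrightarrow>
        \<exists>j. j \<in> S \<and> cball (fst i) (b * snd i) \<subseteq> ball (fst j) (5 * (b * snd j))"
      by (smt (verit))
    have S_D: "p \<in> gauss_D" "0 < snd p" if "p \<in> S" for p
      using that S by (auto simp: half_full_def mem_gauss_D_iff)
    define U where "U p = ball (fst p) (5 * b * snd p)" for p :: "'a \<times> real"
    define V where "V p = ball (fst p) (a * snd p) \<inter> E" for p :: "'a \<times> real"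
    have V_borel: "V p \<in> sets gauss_measure" for p
      by (simp add: V_def)
    have U_borel: "U p \<in> sets gauss_measure" for p
      by (simp add: U_def)
    have halo_sub: "\<exists>p\<in>S. x \<in> U p" if x: "x \<in> halo a b E" for x
    proof -
      from x obtain p where p: "p \<in> half_full a E" "x \<in> ball (fst p) (b * snd p)"
        by (auto simp: halo_def)
      obtain j where "j \<in> S" "cball (fst p) (b * snd p) \<subseteq> ball (fst j) (5 * (b * snd j))"
        using cover[OF p(1)] by blast
      moreover have "x \<in> cball (fst p) (b * snd p)"
        using p(2) by simp
      ultimately show ?thesis
        unfolding U_def mult.assoc by (meson subsetD)
    qed
    have V_disj: "disjoint_family_on V S"
      unfolding disjoint_family_on_def
    proof (intro ballI impI)
      fix p r assume pr: "p \<in> S" "r \<in> S" "p \<noteq> r"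
      have V_sub: "V s \<subseteq> cball (fst s) (b * snd s)" if "s \<in> S" for s
      proof -
        have "a * snd s \<le> b * snd s"
          using ab S_D[OF that] by simp
        then show ?thesis
          unfolding V_def by (auto simp: mem_ball mem_cball)
      qed
      have "cball (fst p) (b * snd p) \<inter> cball (fst r) (b * snd r) = {}"
        using pairwiseD[OF disj pr] by (simp add: disjnt_def)
      then show "V p \<inter> V r = {}"
        using V_sub[OF pr(1)] V_sub[OF pr(2)] by blast
    qed
    have "emeasure gauss_measure (halo a b E)
        = (\<integral>\<^sup>+x. indicator (halo a b E) x \<partial>gauss_measure)"
      by simp
    also have "\<dots> \<le> (\<integral>\<^sup>+x. (\<integral>\<^sup>+p. indicator (U p) x \<partial>count_space S) \<partial>gauss_measure)"
    proof (rule nn_integral_mono)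
      fix x
      show "indicator (halo a b E) x \<le> (\<integral>\<^sup>+p. indicator (U p) x \<partial>count_space S)"
      proof (cases "x \<in> halo a b E")
        case True
        then obtain p where p: "p \<in> S" "x \<in> U p"
          using halo_sub by blast
        \<comment> \<open>The integral counts the balls that contain \<open>x\<close>.\<close>
        have "(1::ennreal) = (\<integral>\<^sup>+r. indicator {p} r \<partial>count_space S)"
          using p(1) by (simp add: one_ennreal_def)
        also have "\<dots> \<le> (\<integral>\<^sup>+r. indicator (U r) x \<partial>count_space S)"
          using p(2) by (intro nn_integral_mono) (auto split: split_indicator)
        finally show ?thesis
          using True by simp
      qed simp
    qed
    also have "\<dots> = (\<integral>\<^sup>+p. (\<integral>\<^sup>+x. indicator (U p) x \<partial>gauss_measure) \<partial>count_space S)"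
      using S(1) U_borel by (intro nn_integral_count_space_nn_integral borel_measurable_indicator) auto
    also have "\<dots> = (\<integral>\<^sup>+p. emeasure gauss_measure (U p) \<partial>count_space S)"
      by (simp add: U_def)
    also have "\<dots> \<le> (\<integral>\<^sup>+p. ennreal (C * 2) * emeasure gauss_measure (V p) \<partial>count_space S)"
    proof (rule nn_integral_mono)
      fix p assume "p \<in> space (count_space S)"
      then have p: "p \<in> S"
        by simp
      have "emeasure gauss_measure (U p) \<le> ennreal C * emeasure gauss_measure (ball (fst p) (a * snd p))"
        using dbl[of "fst p" "snd p"] S_D[OF p] by (simp add: U_def)
      also have "\<dots> \<le> ennreal C * (2 * emeasure gauss_measure (V p))"
        using p S(2) C by (intro mult_left_mono less_imp_le) (auto simp: half_full_def V_def)
      also have "\<dots> = ennreal (C * 2) * emeasure gauss_measure (V p)"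
        using C by (simp add: ennreal_mult mult.assoc)
      finally show "emeasure gauss_measure (U p) \<le> ennreal (C * 2) * emeasure gauss_measure (V p)" .
    qed
    also have "\<dots> = ennreal (C * 2) * (\<integral>\<^sup>+p. emeasure gauss_measure (V p) \<partial>count_space S)"
      by (intro nn_integral_cmult) simp
    also have "(\<integral>\<^sup>+p. emeasure gauss_measure (V p) \<partial>count_space S) = emeasure gauss_measure (\<Union>p\<in>S. V p)"
      using S(1) V_disj V_borel by (intro emeasure_UN_countable[symmetric]) auto
    also have "ennreal (C * 2) * \<dots> \<le> ennreal (C * 2) * emeasure gauss_measure E"
      by (intro mult_left_mono emeasure_mono) (auto simp: V_def)
    finally show ?thesis .
  qed
  with C show ?thesis
    by (intro that[of "C * 2"]) auto
qed

text \<open>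
  If \<open>B(y, a t)\<close> is more than half full, then \<open>B(y, b t)\<close> lies in the halo and the left-hand side is
  \<open>0\<close>. Otherwise the part of \<open>B(y, a t)\<close> outside \<open>E\<close> carries at least half of its measure, and
  doubling applies.
\<close>

lemma emeasure_ball_diff_halo_le:
  assumes a: "0 < a" and ab: "a \<le> b"
  obtains C where "0 < C"
    "\<And>(E :: 'a::euclidean_space set) y t. E \<in> sets borel \<Longrightarrow> (y, t) \<in> gauss_D \<Longrightarrow>
       emeasure gauss_measure (ball y (b * t) - halo a b E)
       \<le> ennreal C * emeasure gauss_measure (ball y (a * t) - E)"
proof -
  obtain C where C: "0 < C"
    and dbl: "\<And>(y :: 'a) t. (y, t) \<in> gauss_D \<Longrightarrow>
      emeasure gauss_measure (ball y (b * t)) \<le> ennreal C * emeasure gauss_measure (ball y (a * t))"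
    using gauss_doubling[of a b] a ab by auto
  have "emeasure gauss_measure (ball y (b * t) - halo a b E)
      \<le> ennreal (C * 2) * emeasure gauss_measure (ball y (a * t) - E)"
    if E [measurable]: "E \<in> sets borel" and yt: "(y, t) \<in> gauss_D" for E :: "'a set" and y t
  proof (cases "(y, t) \<in> half_full a E")
    case True
    then have "ball y (b * t) - halo a b E = {}"
      by (auto simp: halo_def)
    then show ?thesis
      by (metis emeasure_empty zero_le)
  next
    case False
    define B where "B = ball y (a * t)"
    have [measurable]: "B \<in> sets borel"
      by (simp add: B_def)
    have fin: "emeasure gauss_measure (B \<inter> E) < \<infinity>"
      by (intro emeasure_gauss_bounded) (auto simp: B_def bounded_Int)
    have split: "emeasure gauss_measure B = emeasure gauss_measure (B \<inter> E) + emeasure gauss_measure (B - E)"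
      by (subst plus_emeasure) (auto intro: arg_cong[where f = "emeasure gauss_measure"])
    have "emeasure gauss_measure (B \<inter> E) + emeasure gauss_measure (B \<inter> E)
        \<le> emeasure gauss_measure (B \<inter> E) + emeasure gauss_measure (B - E)"
      using False yt split by (simp add: half_full_def B_def mult_2 not_less)
    then have "emeasure gauss_measure (B \<inter> E) \<le> emeasure gauss_measure (B - E)"
      using fin by (auto simp: ennreal_add_left_cancel_le)
    then have le: "emeasure gauss_measure B \<le> 2 * emeasure gauss_measure (B - E)"
      unfolding split mult_2 by (intro add_right_mono)
    have "emeasure gauss_measure (ball y (b * t) - halo a b E) \<le> emeasure gauss_measure (ball y (b * t))"
      by (intro emeasure_mono) auto
    also have "\<dots> \<le> ennreal C * emeasure gauss_measure B"
      unfolding B_def by (rule dbl[OF yt])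
    also have "\<dots> \<le> ennreal C * (2 * emeasure gauss_measure (B - E))"
      by (intro mult_left_mono le) simp
    finally show ?thesis
      using C by (simp add: ennreal_mult mult.assoc B_def)
  qed
  with C show ?thesis
    by (intro that[of "C * 2"]) auto
qed

section \<open>Integrating the measures of cones\<close>

lemma cone_relation_borel:
  "{(x :: 'a::euclidean_space, p). p \<in> gauss_cone a x} \<in> sets borel"
proof -
  have "{(x :: 'a, p). p \<in> gauss_cone a x}
      = (UNIV \<times> gauss_D) \<inter> {z. dist (fst (snd z)) (fst z) < a * snd (snd z)}"
    by (auto simp: gauss_cone_def)
  also have "open \<dots>"
    by (intro open_Int open_Times open_UNIV open_gauss_D open_Collect_less continuous_intros)
  finally show ?thesis
    by (rule borel_open)
qed

lemma gauss_cone_borel [measurable]: "gauss_cone a x \<in> sets borel"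
proof -
  have "gauss_cone a x = gauss_D \<inter> {z. dist (fst z) x < a * snd z}"
    by (auto simp: gauss_cone_def)
  also have "open \<dots>"
    by (intro open_Int open_gauss_D open_Collect_less continuous_intros)
  finally show ?thesis
    by (rule borel_open)
qed

lemma cone_indicator_measurable:
  fixes M :: "('a::euclidean_space \<times> real) measure"
  assumes "sets N = sets borel" "sets M = sets borel"
  shows "(\<lambda>(x, p). indicator (gauss_cone a x) p :: ennreal) \<in> borel_measurable (N \<Otimes>\<^sub>M M)"
proof -
  have "sets (N \<Otimes>\<^sub>M M) = sets ((borel :: 'a measure) \<Otimes>\<^sub>M (borel :: ('a \<times> real) measure))"
    using assms by (intro sets_pair_measure_cong)
  then have "{(x :: 'a, p). p \<in> gauss_cone a x} \<in> sets (N \<Otimes>\<^sub>M M)"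
    using cone_relation_borel[of a] unfolding borel_prod by simp
  from borel_measurable_indicator[OF this] show ?thesis
    by (rule measurable_cong[THEN iffD1, rotated]) (auto split: split_indicator)
qed

lemma emeasure_cone_measurable:
  assumes "sigma_finite_measure M" and [measurable_cong]: "sets M = sets borel"
  shows "(\<lambda>x. emeasure M (gauss_cone a x)) \<in> borel_measurable borel"
proof -
  interpret sigma_finite_measure M by fact
  have "(\<lambda>x. \<integral>\<^sup>+p. indicator (gauss_cone a x) p \<partial>M) \<in> borel_measurable borel"
    by (intro borel_measurable_nn_integral cone_indicator_measurable) (simp_all add: assms)
  then show ?thesis
    by (subst (asm) nn_integral_indicator) (auto simp: assms)
qed

text \<open>
  Fubini's theorem: \<open>(y,t) \<in> D\<close> belongs to the cone at \<open>x\<close> if and only if \<open>x \<in> B(y, a t)\<close>. This reduces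
  an inequality between integrals of cone measures to one between the measures of single balls.
\<close>

lemma nn_integral_emeasure_cone:
  fixes M :: "('a::euclidean_space \<times> real) measure"
  assumes M: "sigma_finite_measure M" "sets M = sets borel" and A [measurable]: "A \<in> sets borel"
  shows "(\<integral>\<^sup>+x. emeasure M (gauss_cone a x) * indicator A x \<partial>gauss_measure)
       = (\<integral>\<^sup>+p. indicator gauss_D p * emeasure gauss_measure (ball (fst p) (a * snd p) \<inter> A) \<partial>M)"
proof -
  interpret M: sigma_finite_measure M by fact
  interpret P: pair_sigma_finite gauss_measure M ..
  have [measurable]: "(\<lambda>(x, p). indicator (gauss_cone a x) p :: ennreal)
      \<in> borel_measurable (gauss_measure \<Otimes>\<^sub>M M)"
    by (intro cone_indicator_measurable) (simp_all add: M)
  have meas: "(\<lambda>(x, p). indicator (gauss_cone a x) p * indicator A x :: ennreal)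
      \<in> borel_measurable (gauss_measure \<Otimes>\<^sub>M M)"
    by measurable
  have "(\<integral>\<^sup>+x. emeasure M (gauss_cone a x) * indicator A x \<partial>gauss_measure)
      = (\<integral>\<^sup>+x. (\<integral>\<^sup>+p. indicator (gauss_cone a x) p * indicator A x \<partial>M) \<partial>gauss_measure)"
    by (intro nn_integral_cong) (simp add: nn_integral_multc M)
  also have "\<dots> = (\<integral>\<^sup>+p. (\<integral>\<^sup>+x. indicator (gauss_cone a x) p * indicator A x \<partial>gauss_measure) \<partial>M)"
    by (rule P.Fubini'[OF meas, symmetric])
  also have "\<dots> = (\<integral>\<^sup>+p. (\<integral>\<^sup>+x. indicator gauss_D p * indicator (ball (fst p) (a * snd p) \<inter> A) x \<partial>gauss_measure) \<partial>M)"
    by (intro nn_integral_cong) (auto simp: gauss_cone_def split: split_indicator)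
  also have "\<dots> = (\<integral>\<^sup>+p. indicator gauss_D p * emeasure gauss_measure (ball (fst p) (a * snd p) \<inter> A) \<partial>M)"
    by (intro nn_integral_cong nn_integral_cmult_indicator) simp
  finally show ?thesis .
qed

section \<open>Distribution functions and powers\<close>

lemma nn_integral_powr_below:
  assumes r: "0 < r" and s: "0 \<le> s"
  shows "(\<integral>\<^sup>+l. ennreal (r * l powr (r - 1)) * indicator {0<..<s} l \<partial>lborel) = ennreal (s powr r)"
proof -
  have "((\<lambda>l. r * l powr (r - 1)) has_integral (r * (s powr (r - 1 + 1) / (r - 1 + 1)))) {0..s}"
    using r s by (intro has_integral_mult_right has_integral_powr_from_0) auto
  then have I: "((\<lambda>l. r * l powr (r - 1)) has_integral (s powr r)) {0..s}"
    using r by simp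
  have "(\<integral>\<^sup>+l. ennreal (r * l powr (r - 1)) * indicator {0<..<s} l \<partial>lborel)
      = (\<integral>\<^sup>+l. ennreal (indicator {0..s} l * (r * l powr (r - 1))) \<partial>lborel)"
    using AE_lborel_singleton[of s] AE_lborel_singleton[of 0]
    by (intro nn_integral_cong_AE, eventually_elim) (auto split: split_indicator)
  also have "\<dots> = ennreal (s powr r)"
    using r by (intro nn_integral_has_integral_lebesgue[OF _ I]) auto
  finally show ?thesis .
qed

lemma nn_integral_powr_above:
  assumes r: "r < 1" "0 < r" and s: "0 < s"
  shows "(\<integral>\<^sup>+l. ennreal (r * l powr (r - 2)) * indicator {s..} l \<partial>lborel)
       = ennreal (r / (1 - r) * s powr (r - 1))"
proof -
  have "((\<lambda>l. r * l powr (r - 2)) has_integral (r * (- (s powr (r - 2 + 1)) / (r - 2 + 1)))) {s..}"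
    using r s by (intro has_integral_mult_right has_integral_powr_to_inf) auto
  moreover have "r * (- (s powr (r - 2 + 1)) / (r - 2 + 1)) = r / (1 - r) * s powr (r - 1)"
    using r by (simp add: field_simps)
  ultimately have I: "((\<lambda>l. r * l powr (r - 2)) has_integral (r / (1 - r) * s powr (r - 1))) {s..}"
    by simp
  have "(\<integral>\<^sup>+l. ennreal (r * l powr (r - 2)) * indicator {s..} l \<partial>lborel)
      = (\<integral>\<^sup>+l. ennreal (indicator {s..} l * (r * l powr (r - 2))) \<partial>lborel)"
    by (intro nn_integral_cong) (auto split: split_indicator)
  also have "\<dots> = ennreal (r / (1 - r) * s powr (r - 1))"
    using r by (intro nn_integral_has_integral_lebesgue[OF _ I]) auto
  finally show ?thesis .
qed

lemma (in sigma_finite_measure) nn_integral_powr_eq_distribution: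
  fixes u :: "'a \<Rightarrow> real"
  assumes r: "0 < r" and u [measurable]: "u \<in> borel_measurable M" and nonneg: "\<And>x. 0 \<le> u x"
  shows "(\<integral>\<^sup>+x. ennreal (u x powr r) \<partial>M)
       = (\<integral>\<^sup>+l. ennreal (r * l powr (r - 1)) * indicator {0<..} l * emeasure M {x \<in> space M. l < u x} \<partial>lborel)"
proof -
  interpret P: pair_sigma_finite M lborel ..
  define f where "f x l = ennreal (r * l powr (r - 1)) * indicator {0<..} l
      * indicator {x \<in> space M. l < u x} x" for x l
  have meas: "case_prod f \<in> borel_measurable (M \<Otimes>\<^sub>M lborel)"
    unfolding f_def by measurable
  have "(\<integral>\<^sup>+x. ennreal (u x powr r) \<partial>M) = (\<integral>\<^sup>+x. (\<integral>\<^sup>+l. f x l \<partial>lborel) \<partial>M)"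
    unfolding f_def
    by (intro nn_integral_cong, subst nn_integral_powr_below[OF r nonneg, symmetric])
       (auto intro!: nn_integral_cong split: split_indicator)
  also have "\<dots> = (\<integral>\<^sup>+l. (\<integral>\<^sup>+x. f x l \<partial>M) \<partial>lborel)"
    by (rule P.Fubini'[OF meas, symmetric])
  also have "\<dots> = (\<integral>\<^sup>+l. ennreal (r * l powr (r - 1)) * indicator {0<..} l * emeasure M {x \<in> space M. l < u x} \<partial>lborel)"
    unfolding f_def by (intro nn_integral_cong nn_integral_cmult_indicator) measurable
  finally show ?thesis .
qed

lemma (in sigma_finite_measure) nn_integral_powr_eq_truncated_means:
  fixes v :: "'a \<Rightarrow> real"
  assumes r: "0 < r" "r < 1" and v [measurable]: "v \<in> borel_measurable M" and nonneg: "\<And>x. 0 \<le> v x"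
  shows "(\<integral>\<^sup>+l. ennreal (r * l powr (r - 1)) * indicator {0<..} l *
            (ennreal (1 / l) * (\<integral>\<^sup>+x. ennreal (v x) * indicator {x. v x \<le> l} x \<partial>M)) \<partial>lborel)
       = ennreal (r / (1 - r)) * (\<integral>\<^sup>+x. ennreal (v x powr r) \<partial>M)"
proof -
  interpret P: pair_sigma_finite M lborel ..
  define f where "f x l = (ennreal (r * l powr (r - 1)) * indicator {0<..} l * ennreal (1 / l))
      * (ennreal (v x) * indicator {x. v x \<le> l} x)" for x l
  have meas: "case_prod f \<in> borel_measurable (M \<Otimes>\<^sub>M lborel)"
    unfolding f_def by measurable
  have "(\<integral>\<^sup>+l. ennreal (r * l powr (r - 1)) * indicator {0<..} l *
            (ennreal (1 / l) * (\<integral>\<^sup>+x. ennreal (v x) * indicator {x. v x \<le> l} x \<partial>M)) \<partial>lborel)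
      = (\<integral>\<^sup>+l. (\<integral>\<^sup>+x. f x l \<partial>M) \<partial>lborel)"
    unfolding f_def by (subst nn_integral_cmult) (simp_all add: mult.assoc)
  also have "\<dots> = (\<integral>\<^sup>+x. (\<integral>\<^sup>+l. f x l \<partial>lborel) \<partial>M)"
    by (rule P.Fubini'[OF meas])
  also have "\<dots> = (\<integral>\<^sup>+x. ennreal (r / (1 - r)) * ennreal (v x powr r) \<partial>M)"
  proof (rule nn_integral_cong)
    fix x
    show "(\<integral>\<^sup>+l. f x l \<partial>lborel) = ennreal (r / (1 - r)) * ennreal (v x powr r)"
    proof (cases "v x = 0")
      case True
      then show ?thesis
        by (simp add: f_def)
    next
      case False
      with nonneg[of x] have pos: "0 < v x"
        by simp
      have "f x l = ennreal (v x) * (ennreal (r * l powr (r - 2)) * indicator {v x..} l)" for l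
      proof (cases "v x \<le> l")
        case True
        with pos have l: "0 < l"
          by simp
        have "l powr (r - 2) = l powr (r - 1) * (1 / l)"
          using l by (simp add: powr_diff powr_numeral power2_eq_square)
        then have "ennreal (r * l powr (r - 2)) = ennreal (r * l powr (r - 1)) * ennreal (1 / l)"
          using l r by (subst ennreal_mult[symmetric]) simp_all
        then show ?thesis
          using True l by (simp only: f_def) (simp add: ac_simps)
      qed (simp add: f_def)
      then have "(\<integral>\<^sup>+l. f x l \<partial>lborel)
          = ennreal (v x) * ennreal (r / (1 - r) * v x powr (r - 1))"
        using nn_integral_powr_above[OF r(2,1) pos] by (simp add: nn_integral_cmult)
      also have "\<dots> = ennreal (r / (1 - r) * (v x * v x powr (r - 1)))"
        using pos r by (subst ennreal_mult'[symmetric]) (simp_all add: mult.left_commute)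
      also have "v x * v x powr (r - 1) = v x powr r"
        using pos by (simp add: powr_diff)
      also have "ennreal (r / (1 - r) * v x powr r) = ennreal (r / (1 - r)) * ennreal (v x powr r)"
        using r by (intro ennreal_mult) simp_all
      finally show ?thesis .
    qed
  qed
  also have "\<dots> = ennreal (r / (1 - r)) * (\<integral>\<^sup>+x. ennreal (v x powr r) \<partial>M)"
    by (intro nn_integral_cmult) measurable
  finally show ?thesis .
qed

text \<open>
  The condition \<open>r < 1\<close> serves the truncated mean of \<open>v\<close>: after an exchange of integrals it
  contributes \<open>v \<cdot> \<integral> r l\<^sup>r\<^sup>-\<^sup>2 dl\<close> over \<open>l \<ge> v\<close>, which is \<open>r / (1 - r) \<cdot> v\<^sup>r\<close>. The first term contributes
  \<open>v\<^sup>r\<close>, and \<open>1 + r / (1 - r) = 1 / (1 - r)\<close>.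
\<close>

lemma (in sigma_finite_measure) nn_integral_powr_le_of_distribution_bound:
  fixes u v :: "'a \<Rightarrow> real"
  assumes r: "0 < r" "r < 1"
    and u [measurable]: "u \<in> borel_measurable M" and v [measurable]: "v \<in> borel_measurable M"
    and nonneg: "\<And>x. 0 \<le> u x" "\<And>x. 0 \<le> v x"
    and bound: "\<And>l. 0 < l \<Longrightarrow> emeasure M {x \<in> space M. l < u x}
       \<le> C * emeasure M {x \<in> space M. l < v x}
         + C * (ennreal (1 / l) * (\<integral>\<^sup>+x. ennreal (v x) * indicator {x. v x \<le> l} x \<partial>M))"
  shows "(\<integral>\<^sup>+x. ennreal (u x powr r) \<partial>M) \<le> C * ennreal (1 / (1 - r)) * (\<integral>\<^sup>+x. ennreal (v x powr r) \<partial>M)"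
proof -
  define W where "W l = ennreal (r * l powr (r - 1)) * indicator {0<..} l" for l
  have [measurable]: "W \<in> borel_measurable lborel"
    unfolding W_def by measurable
  define A where "A l = emeasure M {x \<in> space M. l < v x}" for l
  define B where "B l = ennreal (1 / l) * (\<integral>\<^sup>+x. ennreal (v x) * indicator {x. v x \<le> l} x \<partial>M)" for l
  have [measurable]: "A \<in> borel_measurable lborel" "B \<in> borel_measurable lborel"
    unfolding A_def B_def by measurable
  have "(\<integral>\<^sup>+x. ennreal (u x powr r) \<partial>M) = (\<integral>\<^sup>+l. W l * emeasure M {x \<in> space M. l < u x} \<partial>lborel)"
    unfolding W_def using r nonneg by (intro nn_integral_powr_eq_distribution) auto
  also have "\<dots> \<le> (\<integral>\<^sup>+l. W l * (C * A l + C * B l) \<partial>lborel)"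
  proof (rule nn_integral_mono)
    fix l :: real
    show "W l * emeasure M {x \<in> space M. l < u x} \<le> W l * (C * A l + C * B l)"
    proof (cases "0 < l")
      case True
      then show ?thesis
        unfolding A_def B_def by (intro mult_left_mono bound) auto
    qed (simp add: W_def)
  qed
  also have "\<dots> = (\<integral>\<^sup>+l. C * (W l * A l) + C * (W l * B l) \<partial>lborel)"
    by (simp add: distrib_left mult.left_commute)
  also have "\<dots> = C * (\<integral>\<^sup>+l. W l * A l \<partial>lborel) + C * (\<integral>\<^sup>+l. W l * B l \<partial>lborel)"
    by (simp add: nn_integral_add nn_integral_cmult)
  also have "(\<integral>\<^sup>+l. W l * A l \<partial>lborel) = (\<integral>\<^sup>+x. ennreal (v x powr r) \<partial>M)"
    unfolding W_def A_def using r nonneg by (intro nn_integral_powr_eq_distribution[symmetric]) auto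
  also have "(\<integral>\<^sup>+l. W l * B l \<partial>lborel) = ennreal (r / (1 - r)) * (\<integral>\<^sup>+x. ennreal (v x powr r) \<partial>M)"
    unfolding W_def B_def using r nonneg by (intro nn_integral_powr_eq_truncated_means) auto
  also have "C * (\<integral>\<^sup>+x. ennreal (v x powr r) \<partial>M) + C * (ennreal (r / (1 - r)) * (\<integral>\<^sup>+x. ennreal (v x powr r) \<partial>M))
      = C * (1 + ennreal (r / (1 - r))) * (\<integral>\<^sup>+x. ennreal (v x powr r) \<partial>M)"
    by (simp add: distrib_left distrib_right mult.assoc)
  also have "1 + ennreal (r / (1 - r)) = ennreal (1 / (1 - r))"
    using r by (simp add: field_simps flip: ennreal_1 ennreal_plus)
  finally show ?thesis .
qed

section \<open>Change of aperture for a measure on the domain\<close>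

text \<open>
  The two apertures are compared at a single level. The level set of the larger aperture is
  divided into the part inside the halo of \<open>E = {x. l < M(\<Gamma>\<^sub>a(x))}\<close>, where \<open>\<Gamma>\<^sub>a(x)\<close> is the cone at
  \<open>x\<close>, and the rest, where Markov's inequality applies.
\<close>

lemma cone_distribution_bound:
  assumes a: "0 < a" and ab: "a \<le> b"
  obtains C where "0 < C"
    "\<And>(M :: ('a::euclidean_space \<times> real) measure) l.
       finite_measure M \<Longrightarrow> sets M = sets borel \<Longrightarrow> 0 < l \<Longrightarrow>
       emeasure gauss_measure {x. l < measure M (gauss_cone b x)}
       \<le> ennreal C * emeasure gauss_measure {x. l < measure M (gauss_cone a x)}
         + ennreal C * (ennreal (1 / l) * (\<integral>\<^sup>+x. ennreal (measure M (gauss_cone a x))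
             * indicator {x. measure M (gauss_cone a x) \<le> l} x \<partial>gauss_measure))"
proof -
  obtain C1 where C1: "0 < C1" and halo: "\<And>E :: 'a::euclidean_space set. E \<in> sets borel \<Longrightarrow>
      emeasure gauss_measure (halo a b E) \<le> ennreal C1 * emeasure gauss_measure E"
    by (rule emeasure_halo_le[OF a ab], rule that, assumption, blast)
  obtain C2 where C2: "0 < C2" and diff: "\<And>(E :: 'a::euclidean_space set) y t. E \<in> sets borel \<Longrightarrow>
      (y, t) \<in> gauss_D \<Longrightarrow> emeasure gauss_measure (ball y (b * t) - halo a b E)
       \<le> ennreal C2 * emeasure gauss_measure (ball y (a * t) - E)"
    by (rule emeasure_ball_diff_halo_le[OF a ab], rule that, assumption, blast)
  define C where "C = max C1 C2"
  have "emeasure gauss_measure {x. l < measure M (gauss_cone b x)}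
       \<le> ennreal C * emeasure gauss_measure {x. l < measure M (gauss_cone a x)}
         + ennreal C * (ennreal (1 / l) * (\<integral>\<^sup>+x. ennreal (measure M (gauss_cone a x))
             * indicator {x. measure M (gauss_cone a x) \<le> l} x \<partial>gauss_measure))"
    if M: "finite_measure M" "sets M = sets borel" and l: "0 < l"
    for M :: "('a::euclidean_space \<times> real) measure" and l
  proof -
    interpret M: finite_measure M by fact
    note [measurable_cong] = M(2)
    note M' = M.sigma_finite_measure_axioms M(2)
    define S where "S c x = measure M (gauss_cone c x)" for c x
    have S: "emeasure M (gauss_cone c x) = ennreal (S c x)" for c x
      by (simp add: S_def M.emeasure_eq_measure)
    have [measurable]: "S c \<in> borel_measurable borel" for c
      unfolding S_def measure_def
      by (intro borel_measurable_enn2real emeasure_cone_measurable M')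
    define E where "E = {x. l < S a x}"
    have [measurable]: "E \<in> sets borel"
      unfolding E_def by measurable
    define H where "H = halo a b E"
    have [measurable]: "H \<in> sets borel"
      by (simp add: H_def)
    have mass: "(\<integral>\<^sup>+x. ennreal (S b x) * indicator (- H) x \<partial>gauss_measure)
        \<le> ennreal C2 * (\<integral>\<^sup>+x. ennreal (S a x) * indicator (- E) x \<partial>gauss_measure)"
    proof -
      have "(\<integral>\<^sup>+x. ennreal (S b x) * indicator (- H) x \<partial>gauss_measure)
          = (\<integral>\<^sup>+p. indicator gauss_D p * emeasure gauss_measure (ball (fst p) (b * snd p) \<inter> - H) \<partial>M)"
        unfolding S[symmetric] by (intro nn_integral_emeasure_cone M') simp
      also have "\<dots> \<le> (\<integral>\<^sup>+p. ennreal C2 * (indicator gauss_D p *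
          emeasure gauss_measure (ball (fst p) (a * snd p) \<inter> - E)) \<partial>M)"
      proof (rule nn_integral_mono)
        fix p
        show "indicator gauss_D p * emeasure gauss_measure (ball (fst p) (b * snd p) \<inter> - H)
            \<le> ennreal C2 * (indicator gauss_D p * emeasure gauss_measure (ball (fst p) (a * snd p) \<inter> - E))"
          using diff[of E "fst p" "snd p"]
          by (cases "p \<in> gauss_D") (simp_all add: H_def Diff_eq)
      qed
      also have "\<dots> = ennreal C2 * (\<integral>\<^sup>+p. indicator gauss_D p *
          emeasure gauss_measure (ball (fst p) (a * snd p) \<inter> - E) \<partial>M)"
        by (intro nn_integral_cmult) measurable
      also have "(\<integral>\<^sup>+p. indicator gauss_D p * emeasure gauss_measure (ball (fst p) (a * snd p) \<inter> - E) \<partial>M)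
          = (\<integral>\<^sup>+x. ennreal (S a x) * indicator (- E) x \<partial>gauss_measure)"
        unfolding S[symmetric] by (intro nn_integral_emeasure_cone[symmetric] M') simp
      finally show ?thesis .
    qed
    have "1 \<le> ennreal (1 / l) * ennreal (S b x)" if "l < S b x" for x
    proof -
      have "ennreal 1 \<le> ennreal (1 / l * S b x)"
        using that l by (intro ennreal_leI) simp
      also have "\<dots> = ennreal (1 / l) * ennreal (S b x)"
        using l by (intro ennreal_mult') simp
      finally show ?thesis
        by simp
    qed
    then have "{x. l < S b x} \<subseteq> H \<union> {x \<in> - H. 1 \<le> ennreal (1 / l) * ennreal (S b x)}"
      by blast
    then have "emeasure gauss_measure {x. l < S b x}
        \<le> emeasure gauss_measure (H \<union> {x \<in> - H. 1 \<le> ennreal (1 / l) * ennreal (S b x)})"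
      by (rule emeasure_mono) simp
    also have "\<dots> \<le> emeasure gauss_measure H
        + emeasure gauss_measure {x \<in> - H. 1 \<le> ennreal (1 / l) * ennreal (S b x)}"
      by (intro emeasure_subadditive) simp_all
    also have "\<dots> \<le> ennreal C1 * emeasure gauss_measure E
        + ennreal (1 / l) * (\<integral>\<^sup>+x. ennreal (S b x) * indicator (- H) x \<partial>gauss_measure)"
    proof (rule add_mono)
      show "emeasure gauss_measure H \<le> ennreal C1 * emeasure gauss_measure E"
        unfolding H_def by (rule halo) simp
      show "emeasure gauss_measure {x \<in> - H. 1 \<le> ennreal (1 / l) * ennreal (S b x)}
          \<le> ennreal (1 / l) * (\<integral>\<^sup>+x. ennreal (S b x) * indicator (- H) x \<partial>gauss_measure)"
        by (rule nn_integral_Markov_inequality) simp_all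
    qed
    also have "\<dots> \<le> ennreal C1 * emeasure gauss_measure E
        + ennreal (1 / l) * (ennreal C2 * (\<integral>\<^sup>+x. ennreal (S a x) * indicator (- E) x \<partial>gauss_measure))"
      by (intro add_left_mono mult_left_mono mass) simp
    also have "\<dots> \<le> ennreal C * emeasure gauss_measure E
        + ennreal C * (ennreal (1 / l) * (\<integral>\<^sup>+x. ennreal (S a x) * indicator (- E) x \<partial>gauss_measure))"
      unfolding mult.left_commute[of "ennreal (1 / l)"]
      by (intro add_mono mult_right_mono ennreal_leI) (auto simp: C_def)
    also have "- E = {x. S a x \<le> l}"
      by (auto simp: E_def)
    finally show ?thesis
      unfolding E_def S_def .
  qed
  with C1 show ?thesis
    by (intro that[of C]) (auto simp: C_def)
qed

theorem cone_change_of_aperture: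
  assumes a: "0 < a" and ab: "a \<le> b" and r: "0 < r" "r < 1"
  obtains C where "0 < C"
    "\<And>M :: ('a::euclidean_space \<times> real) measure.
       finite_measure M \<Longrightarrow> sets M = sets borel \<Longrightarrow>
       (\<integral>\<^sup>+x. ennreal (measure M (gauss_cone b x) powr r) \<partial>gauss_measure)
       \<le> ennreal C * (\<integral>\<^sup>+x. ennreal (measure M (gauss_cone a x) powr r) \<partial>gauss_measure)"
proof -
  obtain C where C: "0 < C" and bound: "\<And>(M :: ('a::euclidean_space \<times> real) measure) l.
       finite_measure M \<Longrightarrow> sets M = sets borel \<Longrightarrow> 0 < l \<Longrightarrow>
       emeasure gauss_measure {x. l < measure M (gauss_cone b x)}
       \<le> ennreal C * emeasure gauss_measure {x. l < measure M (gauss_cone a x)}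
         + ennreal C * (ennreal (1 / l) * (\<integral>\<^sup>+x. ennreal (measure M (gauss_cone a x))
             * indicator {x. measure M (gauss_cone a x) \<le> l} x \<partial>gauss_measure))"
    by (rule cone_distribution_bound[OF a ab], rule that, assumption, blast)
  have "(\<integral>\<^sup>+x. ennreal (measure M (gauss_cone b x) powr r) \<partial>gauss_measure)
       \<le> ennreal (C * (1 / (1 - r))) * (\<integral>\<^sup>+x. ennreal (measure M (gauss_cone a x) powr r) \<partial>gauss_measure)"
    if M: "finite_measure M" "sets M = sets borel" for M :: "('a \<times> real) measure"
  proof -
    interpret M: finite_measure M by fact
    have "(\<lambda>x. measure M (gauss_cone c x)) \<in> borel_measurable borel" for c
      unfolding measure_def
      by (intro borel_measurable_enn2real emeasure_cone_measurable M M.sigma_finite_measure_axioms)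
    then have "(\<integral>\<^sup>+x. ennreal (measure M (gauss_cone b x) powr r) \<partial>gauss_measure)
       \<le> ennreal C * ennreal (1 / (1 - r)) * (\<integral>\<^sup>+x. ennreal (measure M (gauss_cone a x) powr r) \<partial>gauss_measure)"
      using r bound[OF M] by (intro gauss.nn_integral_powr_le_of_distribution_bound) simp_all
    moreover have "ennreal (C * (1 / (1 - r))) = ennreal C * ennreal (1 / (1 - r))"
      using C r by (intro ennreal_mult) simp_all
    ultimately show ?thesis
      by simp
  qed
  with C r show ?thesis
    by (intro that[of "C * (1 / (1 - r))"]) auto
qed

section \<open>The measure attached to a function with compact support\<close>

lemma eq_0_outside_support: "p \<notin> closure {p. f p \<noteq> 0} \<Longrightarrow> f p = 0"
  using closure_subset[of "{p. f p \<noteq> 0}"] by blast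

lemma Cc_D_continuous:
  assumes f: "f \<in> Cc_D"
  shows "continuous_on UNIV f"
proof -
  define K where "K = closure {p. f p \<noteq> 0}"
  have "continuous_on gauss_D f" "K \<subseteq> gauss_D"
    using f by (auto simp: Cc_D_def K_def)
  moreover have "f p = 0" if "p \<in> - K" for p
    using eq_0_outside_support[of _ f, folded K_def] that by blast
  then have "continuous_on (- K) f"
    by (intro continuous_on_eq[OF continuous_on_const[of _ 0]]) metis
  ultimately have "continuous_on (gauss_D \<union> - K) f"
    by (intro continuous_on_open_Un open_gauss_D) (auto simp: K_def)
  moreover have "gauss_D \<union> - K = UNIV"
    using \<open>K \<subseteq> gauss_D\<close> by auto
  ultimately show ?thesis
    by simp
qed

lemma Cc_D_norm_measurable:
  assumes "f \<in> Cc_D"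
  shows "(\<lambda>p. norm (f p)) \<in> borel_measurable borel"
  using Cc_D_continuous[OF assms] by (intro borel_measurable_continuous_onI continuous_intros)

lemma Cc_D_diff:
  assumes f: "f \<in> Cc_D" and g: "g \<in> Cc_D"
  shows "f - g \<in> Cc_D"
proof -
  define K where "K = closure {p. f p \<noteq> 0} \<union> closure {p. g p \<noteq> 0}"
  have K: "compact K" "K \<subseteq> gauss_D"
    using f g by (auto simp: Cc_D_def K_def)
  have "{p. (f - g) p \<noteq> 0} \<subseteq> {p. f p \<noteq> 0} \<union> {p. g p \<noteq> 0}"
    by auto
  then have sub: "closure {p. (f - g) p \<noteq> 0} \<subseteq> K"
    unfolding K_def closure_Un[symmetric] by (rule closure_mono)
  moreover have "compact (closure {p. (f - g) p \<noteq> 0})"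
    using sub K(1) by (metis closed_closure compact_Int_closed inf.absorb_iff2)
  moreover have "continuous_on gauss_D (f - g)"
    using f g unfolding Cc_D_def fun_diff_def by (auto intro!: continuous_intros)
  ultimately show ?thesis
    using K(2) by (auto simp: Cc_D_def)
qed

text \<open>
  A compact subset of \<open>D\<close> lies between two positive values of \<open>t\<close>, where \<open>dt/t\<close> has finite
  mass, and its projection to the first factor is bounded.
\<close>

lemma emeasure_upper_measure_compact:
  assumes K: "compact K" "K \<subseteq> (gauss_D :: ('a::euclidean_space \<times> real) set)"
  shows "emeasure upper_measure K < \<infinity>"
proof (cases "K = {}")
  case False
  obtain p where p: "p \<in> K" "\<And>z. z \<in> K \<Longrightarrow> snd p \<le> snd z"
    using continuous_attains_inf[OF K(1) False, of snd] continuous_on_snd[OF continuous_on_id] by blast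
  define e where "e = snd p"
  have e: "0 < e"
    using p(1) K(2) mem_gauss_D_iff[of "fst p" "snd p"] by (auto simp: e_def)
  have comp: "compact (fst ` K)"
    using K(1) by (intro compact_continuous_image continuous_intros)
  then have [measurable]: "fst ` K \<in> sets borel"
    by (intro borel_closed compact_imp_closed)
  have "K \<subseteq> fst ` K \<times> {e..1}"
  proof
    fix z assume z: "z \<in> K"
    then have "snd z < 1"
      using K(2) mem_gauss_D_iff[of "fst z" "snd z"] by auto
    with z p(2)[OF z] show "z \<in> fst ` K \<times> {e..1}"
      by (cases z) (force simp: e_def)
  qed
  then have "emeasure upper_measure K \<le> emeasure upper_measure (fst ` K \<times> {e..1})"
    using borel_closed[OF compact_imp_closed[OF compact_Times[OF comp compact_Icc]]]
    by (intro emeasure_mono) auto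
  also have "\<dots> = emeasure gauss_measure (fst ` K) * emeasure haar_measure {e..1}"
    unfolding upper_measure_def by (intro haar.emeasure_pair_measure_Times) auto
  also have "\<dots> < \<infinity>"
  proof -
    have "emeasure haar_measure {e..1}
        = (\<integral>\<^sup>+t. ennreal (indicator {0<..} t / t) * indicator {e..1} t \<partial>lborel)"
      unfolding haar_measure_def by (intro emeasure_density) auto
    also have "\<dots> \<le> (\<integral>\<^sup>+t. ennreal (1 / e) * indicator {e..1} t \<partial>lborel)"
      using e by (intro nn_integral_mono)
        (auto intro!: ennreal_leI simp: frac_le split: split_indicator)
    also have "\<dots> = ennreal (1 / e) * emeasure lborel {e..1}"
      by (intro nn_integral_cmult_indicator) simp
    also have "\<dots> < \<infinity>"
      by (cases "e \<le> 1") (simp_all add: ennreal_mult_less_top)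
    finally have "emeasure haar_measure {e..1} < \<infinity>" .
    moreover have "emeasure gauss_measure (fst ` K) < \<infinity>"
      using comp by (intro emeasure_gauss_bounded compact_imp_bounded) simp_all
    ultimately show ?thesis
      by (simp add: ennreal_mult_less_top)
  qed
  finally show ?thesis .
qed simp

text \<open>
  The powers in the integrand of the tent norm are taken once and for all: on the cone at \<open>x\<close> the
  weight is the \<open>q\<close>-th power of the norm of \<open>tent_J\<close>, and it does not depend on \<open>x\<close> or on the aperture.
\<close>

definition tent_weight :: "real \<Rightarrow> ('a::euclidean_space \<times> real \<Rightarrow> 'b::real_normed_field) \<Rightarrow> 'a \<times> real \<Rightarrow> real" where
  "tent_weight q f p = norm (f p) powr q / measure gauss_measure (ball (fst p) (snd p))"

definition tent_measure :: "real \<Rightarrow> ('a::euclidean_space \<times> real \<Rightarrow> 'b::real_normed_field) \<Rightarrow> ('a \<times> real) measure" where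
  "tent_measure q f = density upper_measure (\<lambda>p. ennreal (tent_weight q f p))"

lemma sets_tent_measure [simp]: "sets (tent_measure q f) = sets borel"
  by (simp add: tent_measure_def)

lemma tent_weight_nonneg: "0 \<le> tent_weight q f p"
  by (simp add: tent_weight_def)

lemma tent_weight_measurable:
  assumes "f \<in> Cc_D"
  shows "tent_weight q f \<in> borel_measurable borel"
proof -
  have [measurable]: "(\<lambda>p. norm (f p)) \<in> borel_measurable borel"
    by (rule Cc_D_norm_measurable[OF assms])
  have [measurable]: "(\<lambda>p :: 'a \<times> real. measure gauss_measure (ball (fst p) (snd p))) \<in> borel_measurable borel"
    unfolding measure_def
    using borel_measurable_enn2real[OF emeasure_gauss_ball_measurable[of UNIV 1]] by simp
  show ?thesis
    unfolding tent_weight_def by measurable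
qed

text \<open>
  The measure of \<open>B(y,t)\<close> is replaced by the lower bound \<open>\<psi>\<close> of \<open>emeasure_gauss_ball_ge\<close>. It is
  continuous and positive on \<open>D\<close>, and the quotient of two continuous functions is bounded on the
  compact support of \<open>f\<close>.
\<close>

lemma tent_weight_bounded:
  assumes f: "(f :: 'a::euclidean_space \<times> real \<Rightarrow> 'b::real_normed_field) \<in> Cc_D" and q: "0 < q"
  obtains B where "0 \<le> B" "\<And>p. tent_weight q f p \<le> B * indicator (closure {p. f p \<noteq> 0}) p"
proof -
  define K where "K = closure {p. f p \<noteq> 0}"
  have K: "compact K" "K \<subseteq> gauss_D"
    using f by (auto simp: Cc_D_def K_def)
  \<comment> \<open>The lower bound of \<open>emeasure_gauss_ball_ge\<close> for \<open>\<rho> = 1\<close>.\<close>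
  define \<psi> :: "'a \<times> real \<Rightarrow> real" where "\<psi> p = exp (- (1 * (1 + 2) / 2)) * gauss_density (fst p)
      * (unit_ball_vol (real DIM('a)) * snd p ^ DIM('a))" for p
  have psi_pos: "0 < \<psi> p" if "p \<in> gauss_D" for p
    using that gauss_density_pos[of "fst p"] mem_gauss_D_iff[of "fst p" "snd p"]
    by (simp add: \<psi>_def)
  have psi_le: "\<psi> p \<le> measure gauss_measure (ball (fst p) (snd p))" if "p \<in> gauss_D" for p
  proof -
    have t: "0 < snd p"
      using that mem_gauss_D_iff[of "fst p" "snd p"] by simp
    have "ennreal (\<psi> p) = ennreal (exp (- (1 * (1 + 2) / 2)) * gauss_density (fst p))
        * emeasure lborel (ball (fst p) (1 * snd p))"
      unfolding \<psi>_def using t gauss_density_pos[of "fst p"]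
      by (subst ennreal_mult) (simp_all add: emeasure_ball)
    also have "\<dots> \<le> emeasure gauss_measure (ball (fst p) (1 * snd p))"
      using that by (intro emeasure_gauss_ball_ge) simp
    finally show ?thesis
      using emeasure_gauss_bounded[of "ball (fst p) (snd p)"] psi_pos[OF that]
      by (simp add: measure_def flip: enn2real_leI ennreal_le_iff2)
         (metis enn2real_ennreal enn2real_mono less_imp_le)
  qed
  have "continuous_on K (\<lambda>p. norm (f p) powr q / \<psi> p)"
  proof -
    have "continuous_on K f"
      using Cc_D_continuous[OF f] continuous_on_subset by blast
    then have "continuous_on K (\<lambda>p. norm (f p) powr q)"
      using q by (intro continuous_on_powr' continuous_on_norm continuous_on_const) auto
    moreover have "continuous_on K \<psi>"
      unfolding \<psi>_def gauss_density_def by (intro continuous_intros) auto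
    ultimately show ?thesis
      using K(2) psi_pos by (intro continuous_on_divide) force+
  qed
  then have "compact ((\<lambda>p. norm (f p) powr q / \<psi> p) ` K)"
    using K(1) by (rule compact_continuous_image)
  then have "bounded ((\<lambda>p. norm (f p) powr q / \<psi> p) ` K)"
    by (rule compact_imp_bounded)
  then obtain B where B: "\<And>p. p \<in> K \<Longrightarrow> \<bar>norm (f p) powr q / \<psi> p\<bar> \<le> B"
    unfolding bounded_real by blast
  have "tent_weight q f p \<le> max B 0 * indicator K p" for p
  proof (cases "p \<in> K")
    case True
    then have p: "p \<in> gauss_D"
      using K(2) by auto
    have "tent_weight q f p \<le> norm (f p) powr q / \<psi> p"
      unfolding tent_weight_def using psi_le[OF p] psi_pos[OF p] by (intro divide_left_mono) auto
    also have "\<dots> \<le> max B 0"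
      using B[OF True] by linarith
    finally show ?thesis
      using True by simp
  next
    case False
    then have "f p = 0"
      using eq_0_outside_support[of _ f, folded K_def] by blast
    with False show ?thesis
      using q by (simp add: tent_weight_def)
  qed
  then show ?thesis
    unfolding K_def by (intro that[of "max B 0"]) simp_all
qed

lemma integrable_tent_weight:
  assumes f: "f \<in> Cc_D" and q: "0 < q"
  shows "integrable upper_measure (tent_weight q f)"
proof -
  obtain B where B: "0 \<le> B" "\<And>p. tent_weight q f p \<le> B * indicator (closure {p. f p \<noteq> 0}) p"
    by (rule tent_weight_bounded[OF f q], rule that, assumption, blast)
  have "integrable upper_measure (\<lambda>p. B * indicator (closure {p. f p \<noteq> 0}) p)"
    using f emeasure_upper_measure_compact[of "closure {p. f p \<noteq> 0}"]
    by (intro integrable_mult_right integrable_real_indicator) (auto simp: Cc_D_def)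
  then show ?thesis
  proof (rule Bochner_Integration.integrable_bound)
    show "tent_weight q f \<in> borel_measurable upper_measure"
      using tent_weight_measurable[OF f] by (simp add: measurable_cong_sets[OF sets_upper_measure refl])
    show "AE p in upper_measure. norm (tent_weight q f p) \<le> norm (B * indicator (closure {p. f p \<noteq> 0}) p)"
    proof (rule AE_I2)
      fix p
      show "norm (tent_weight q f p) \<le> norm (B * indicator (closure {p. f p \<noteq> 0}) p)"
        unfolding real_norm_def abs_of_nonneg[OF tent_weight_nonneg]
        by (rule order_trans[OF B(2) abs_ge_self])
    qed
  qed
qed

lemma finite_tent_measure:
  assumes f: "f \<in> Cc_D" and q: "0 < q"
  shows "finite_measure (tent_measure q f)"
proof
  have "emeasure (tent_measure q f) (space (tent_measure q f))
      = (\<integral>\<^sup>+p. ennreal (tent_weight q f p) \<partial>upper_measure)"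
    unfolding tent_measure_def using tent_weight_measurable[OF f]
    by (subst emeasure_density) auto
  also have "\<dots> < \<infinity>"
    using integrable_tent_weight[OF f q] tent_weight_nonneg[of q f]
    by (simp add: integrable_iff_bounded)
  finally show "emeasure (tent_measure q f) (space (tent_measure q f)) \<noteq> \<infinity>"
    by simp
qed

lemma tent_J_powr:
  assumes q: "0 < q"
  shows "indicator gauss_D p *\<^sub>R norm (tent_J a q f x p) powr q
       = indicator (gauss_cone a x) p * tent_weight q f p"
proof (cases "p \<in> gauss_cone a x")
  case True
  then obtain y t where p: "p = (y, t)" "(y, t) \<in> gauss_D" "x \<in> ball y (a * t)"
    by (auto simp: gauss_cone_def)
  have pos: "0 < measure gauss_measure (ball y t)"
    by (rule measure_gauss_ball_pos[OF p(2)])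
  then have "norm (tent_J a q f x p) powr q
      = (norm (f p) / measure gauss_measure (ball y t) powr (1 / q)) powr q"
    using p by (simp add: tent_J_def)
  also have "\<dots> = norm (f p) powr q / measure gauss_measure (ball y t)"
    using q pos by (subst powr_divide) (simp_all add: powr_powr)
  finally show ?thesis
    using True p by (simp add: tent_weight_def)
next
  case False
  then show ?thesis
    by (cases p) (auto simp: gauss_cone_def tent_J_def split: split_indicator)
qed

lemma integrable_tent_J_powr:
  assumes f: "f \<in> Cc_D" and q: "0 < q"
  shows "integrable upper_measure (\<lambda>p. indicator gauss_D p *\<^sub>R norm (tent_J a q f x p) powr q)"
  unfolding tent_J_powr[OF q]
  using integrable_mult_indicator[OF _ integrable_tent_weight[OF f q], of "gauss_cone a x"] by simp

lemma set_integral_tent_J_powr: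
  assumes f: "f \<in> Cc_D" and q: "0 < q"
  shows "(LINT p:gauss_D|upper_measure. norm (tent_J a q f x p) powr q)
       = measure (tent_measure q f) (gauss_cone a x)"
proof -
  have [measurable]: "tent_weight q f \<in> borel_measurable borel"
    by (rule tent_weight_measurable[OF f])
  have "(LINT p:gauss_D|upper_measure. norm (tent_J a q f x p) powr q)
      = (\<integral>p. indicator (gauss_cone a x) p * tent_weight q f p \<partial>upper_measure)"
    unfolding set_lebesgue_integral_def tent_J_powr[OF q] ..
  also have "\<dots> = enn2real (\<integral>\<^sup>+p. ennreal (indicator (gauss_cone a x) p * tent_weight q f p) \<partial>upper_measure)"
    by (intro integral_eq_nn_integral) (auto simp: tent_weight_nonneg)
  also have "(\<integral>\<^sup>+p. ennreal (indicator (gauss_cone a x) p * tent_weight q f p) \<partial>upper_measure)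
      = emeasure (tent_measure q f) (gauss_cone a x)"
    unfolding tent_measure_def
    by (subst emeasure_density) (auto intro!: nn_integral_cong split: split_indicator)
  finally show ?thesis
    by (simp add: measure_def)
qed

lemma tent_norm_eq:
  assumes f: "f \<in> Cc_D" and q: "0 < q"
  shows "tent_norm a q f = (\<integral>x. measure (tent_measure q f) (gauss_cone a x) powr (1 / q) \<partial>gauss_measure)"
  by (simp add: tent_norm_def set_integral_tent_J_powr[OF f q])

lemma measure_tent_cone_measurable:
  assumes f: "f \<in> Cc_D" and q: "0 < q"
  shows "(\<lambda>x. measure (tent_measure q f) (gauss_cone a x)) \<in> borel_measurable borel"
proof -
  interpret finite_measure "tent_measure q f"
    by (rule finite_tent_measure[OF f q])
  show ?thesis
    unfolding measure_def
    by (intro borel_measurable_enn2real emeasure_cone_measurable sigma_finite_measure_axioms) simp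
qed

text \<open>
  A point \<open>(y,t)\<close> of the cone at \<open>x\<close> has \<open>\<bar>x - y\<bar> < a\<close>, and \<open>y\<close> is bounded on the support of \<open>f\<close>. With
  the finiteness of the tent measure this makes every square function integrable, and none of the
  Bochner integrals in the tent norm takes its default value \<open>0\<close>.
\<close>

lemma measure_tent_cone_bounded_support:
  assumes f: "(f :: 'a::euclidean_space \<times> real \<Rightarrow> 'b::real_normed_field) \<in> Cc_D" and a: "0 \<le> a"
  obtains R where "\<And>x. measure (tent_measure q f) (gauss_cone a x) \<noteq> 0 \<Longrightarrow> norm x \<le> R"
proof -
  define K where "K = closure {p. f p \<noteq> 0}"
  have K: "compact K" "K \<subseteq> gauss_D"
    using f by (auto simp: Cc_D_def K_def)
  have "compact (fst ` K)"
    using K(1) by (intro compact_continuous_image continuous_intros)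
  then obtain R where R: "\<And>p. p \<in> K \<Longrightarrow> norm (fst p) \<le> R"
    using compact_imp_bounded[of "fst ` K"] by (auto simp: bounded_iff)
  have "norm x \<le> R + a" if x: "measure (tent_measure q f) (gauss_cone a x) \<noteq> 0" for x
  proof (rule ccontr)
    assume far: "\<not> norm x \<le> R + a"
    have "f p = 0" if p: "p \<in> gauss_cone a x" for p
    proof (rule eq_0_outside_support[of _ f], rule notI)
      assume "p \<in> closure {p. f p \<noteq> 0}"
      then have "norm (fst p) \<le> R"
        using R by (simp add: K_def)
      moreover have "dist (fst p) x < a * snd p" "snd p < 1"
        using p by (auto simp: gauss_cone_def mem_gauss_D_iff)
      moreover have "a * snd p \<le> a"
        using \<open>snd p < 1\<close> a by (simp add: mult_left_le)
      moreover have "norm x \<le> norm (fst p) + dist (fst p) x"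
        using norm_triangle_sub[of x "fst p"] by (simp add: dist_norm norm_minus_commute)
      ultimately show False
        using far by linarith
    qed
    then have "tent_weight q f p = 0" if "p \<in> gauss_cone a x" for p
      using that by (simp add: tent_weight_def)
    then have zero: "ennreal (tent_weight q f p) * indicator (gauss_cone a x) p = 0" for p
      by (cases "p \<in> gauss_cone a x") simp_all
    have "emeasure (tent_measure q f) (gauss_cone a x)
        = (\<integral>\<^sup>+p. ennreal (tent_weight q f p) * indicator (gauss_cone a x) p \<partial>upper_measure)"
      unfolding tent_measure_def using tent_weight_measurable[OF f, of q]
      by (intro emeasure_density) auto
    also have "\<dots> = 0"
      unfolding zero by simp
    finally have "emeasure (tent_measure q f) (gauss_cone a x) = 0" .
    with x show False
      by (simp add: measure_def)
  qed
  then show ?thesis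
    by (rule that)
qed

lemma integrable_tent_square_function:
  assumes f: "(f :: 'a::euclidean_space \<times> real \<Rightarrow> 'b::real_normed_field) \<in> Cc_D" and q: "0 < q" and a: "0 \<le> a"
  shows "integrable gauss_measure (\<lambda>x. measure (tent_measure q f) (gauss_cone a x) powr (1 / q))"
proof -
  interpret finite_measure "tent_measure q f"
    by (rule finite_tent_measure[OF f q])
  note [measurable] = measure_tent_cone_measurable[OF f q, of a]
  obtain R where R: "\<And>x. measure (tent_measure q f) (gauss_cone a x) \<noteq> 0 \<Longrightarrow> norm x \<le> R"
    by (rule measure_tent_cone_bounded_support[OF f a, of q], rule that, blast)
  define T where "T = measure (tent_measure q f) (space (tent_measure q f)) powr (1 / q)"
  have "integrable gauss_measure (\<lambda>x :: 'a. T * indicator (cball 0 R) x)"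
    using emeasure_gauss_bounded[of "cball 0 R :: 'a set"]
    by (intro integrable_mult_right integrable_real_indicator) auto
  then show ?thesis
  proof (rule Bochner_Integration.integrable_bound)
    show "AE x in gauss_measure. norm (measure (tent_measure q f) (gauss_cone a x) powr (1 / q))
        \<le> norm (T * indicator (cball 0 R) x)"
    proof (rule AE_I2)
      fix x
      have "measure (tent_measure q f) (gauss_cone a x) powr (1 / q) \<le> T"
        unfolding T_def using q by (intro powr_mono2 bounded_measure) auto
      then show "norm (measure (tent_measure q f) (gauss_cone a x) powr (1 / q))
        \<le> norm (T * indicator (cball 0 R) x)"
        using R[of x] by (cases "measure (tent_measure q f) (gauss_cone a x) = 0") (auto simp: T_def)
    qed
  qed measurable
qed

section \<open>The triangle inequality for the tent norm\<close>

text \<open>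
  Convexity of \<open>x\<^sup>q\<close> on the closed half-line; at \<open>0\<close> it comes down to \<open>s\<^sup>q \<le> s\<close> for \<open>0 < s < 1\<close>.
\<close>

lemma powr_convex_combination:
  fixes x y :: real
  assumes q: "1 \<le> q" and x: "0 \<le> x" and y: "0 \<le> y" and c: "0 < c" "c < 1"
  shows "(c * x + (1 - c) * y) powr q \<le> c * x powr q + (1 - c) * y powr q"
proof -
  have scale: "(s * z) powr q \<le> s * z powr q" if "0 < s" "s < 1" "0 \<le> z" for s z :: real
  proof -
    have "s powr q \<le> s powr 1"
      using that q by (intro powr_mono') auto
    then show ?thesis
      using that by (simp add: powr_mult mult_right_mono)
  qed
  consider "x = 0" | "y = 0" | "0 < x" "0 < y"
    using x y by linarith
  then show ?thesis
  proof cases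
    case 1
    then show ?thesis
      using scale[of "1 - c" y] c y q by simp
  next
    case 2
    then show ?thesis
      using scale[of c x] c x q by simp
  next
    case 3
    then show ?thesis
      using convex_onD[OF powr_convex[OF q], of "1 - c" x y] c by (simp add: algebra_simps)
  qed
qed

text \<open>
  If \<open>a\<close> and \<open>b\<close> exceed the \<open>L\<^sup>q\<close> norms of \<open>u\<close> and \<open>v\<close>, then \<open>(u + v) / (a + b)\<close> is a convex combination
  of \<open>u / a\<close> and \<open>v / b\<close>, functions of norm at most \<open>1\<close>. Convexity of \<open>x\<^sup>q\<close> bounds its norm by \<open>1\<close>.
  Taking \<open>a\<close> and \<open>b\<close> strictly larger than the norms avoids division by \<open>0\<close>.
\<close>

lemma Minkowski_powr:
  fixes u v w :: "'a \<Rightarrow> real"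
  assumes q: "1 \<le> q"
    and u: "integrable M (\<lambda>x. u x powr q)" and v: "integrable M (\<lambda>x. v x powr q)"
    and nonneg: "\<And>x. 0 \<le> u x" "\<And>x. 0 \<le> v x" "\<And>x. 0 \<le> w x"
    and le: "\<And>x. w x \<le> u x + v x"
  shows "(\<integral>x. w x powr q \<partial>M) powr (1 / q)
       \<le> (\<integral>x. u x powr q \<partial>M) powr (1 / q) + (\<integral>x. v x powr q \<partial>M) powr (1 / q)"
proof (rule field_le_epsilon)
  fix e :: real assume e: "0 < e"
  define a where "a = (\<integral>x. u x powr q \<partial>M) powr (1 / q) + e / 2"
  define b where "b = (\<integral>x. v x powr q \<partial>M) powr (1 / q) + e / 2"
  have ab: "0 < a" "0 < b"
    using e by (auto simp: a_def b_def intro!: add_nonneg_pos)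
  have norm_le: "(\<integral>x. h x powr q \<partial>M) / s powr q \<le> 1"
    if "s = (\<integral>x. h x powr q \<partial>M) powr (1 / q) + e / 2" for h :: "'a \<Rightarrow> real" and s
  proof -
    have I: "0 \<le> (\<integral>x. h x powr q \<partial>M)"
      by (intro integral_nonneg_AE) auto
    have "(\<integral>x. h x powr q \<partial>M) = ((\<integral>x. h x powr q \<partial>M) powr (1 / q)) powr q"
      using I q by (simp add: powr_powr)
    also have "\<dots> \<le> s powr q"
      using e q that by (intro powr_mono2) auto
    finally show ?thesis
      using I by (simp add: divide_le_eq_1)
  qed
  define c where "c = a / (a + b)"
  have c: "0 < c" "c < 1" "1 - c = b / (a + b)"
    using ab by (auto simp: c_def field_simps)
  have pointwise: "w x powr q \<le> (a + b) powr q *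
      (c * (u x powr q / a powr q) + (1 - c) * (v x powr q / b powr q))" for x
  proof -
    have "w x \<le> (a + b) * (c * (u x / a) + (1 - c) * (v x / b))"
      using le[of x] ab unfolding c(3) by (simp add: c_def distrib_left)
    then have "w x powr q \<le> ((a + b) * (c * (u x / a) + (1 - c) * (v x / b))) powr q"
      using q nonneg by (intro powr_mono2) auto
    also have "\<dots> = (a + b) powr q * (c * (u x / a) + (1 - c) * (v x / b)) powr q"
      by (rule powr_mult)
    also have "\<dots> \<le> (a + b) powr q * (c * (u x / a) powr q + (1 - c) * (v x / b) powr q)"
      using ab nonneg by (intro mult_left_mono powr_convex_combination q c) auto
    finally show ?thesis
      using ab nonneg by (simp add: powr_divide)
  qed
  have int: "integrable M (\<lambda>x. (a + b) powr q *
      (c * (u x powr q / a powr q) + (1 - c) * (v x powr q / b powr q)))"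
    by (intro integrable_mult_right Bochner_Integration.integrable_add integrable_divide u v)
  have "(\<integral>x. w x powr q \<partial>M) \<le> (\<integral>x. (a + b) powr q *
      (c * (u x powr q / a powr q) + (1 - c) * (v x powr q / b powr q)) \<partial>M)"
    by (intro integral_mono' int pointwise order_trans[OF powr_ge_zero pointwise])
  also have "\<dots> = (a + b) powr q * (c * ((\<integral>x. u x powr q \<partial>M) / a powr q)
      + (1 - c) * ((\<integral>x. v x powr q \<partial>M) / b powr q))"
    using u v by (simp add: Bochner_Integration.integral_add)
  also have "\<dots> \<le> (a + b) powr q * (c * 1 + (1 - c) * 1)"
    using c(1,2) by (intro mult_left_mono add_mono norm_le) (auto simp: a_def b_def)
  finally have "(\<integral>x. w x powr q \<partial>M) \<le> (a + b) powr q"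
    by simp
  then have "(\<integral>x. w x powr q \<partial>M) powr (1 / q) \<le> ((a + b) powr q) powr (1 / q)"
    using q by (intro powr_mono2) (auto intro!: integral_nonneg_AE)
  also have "\<dots> = a + b"
    using q ab by (simp add: powr_powr)
  finally show "(\<integral>x. w x powr q \<partial>M) powr (1 / q)
      \<le> (\<integral>x. u x powr q \<partial>M) powr (1 / q) + (\<integral>x. v x powr q \<partial>M) powr (1 / q) + e"
    by (simp add: a_def b_def)
qed

lemma tent_norm_nonneg: "0 \<le> tent_norm a q f"
  unfolding tent_norm_def by (intro integral_nonneg_AE) auto

lemma tent_norm_diff_self:
  assumes q: "0 < q"
  shows "tent_norm a q (f - f) = 0"
proof -
  have "tent_J a q (f - f) x p = 0" for x p
    by (cases p) (simp add: tent_J_def)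
  then show ?thesis
    using q by (simp add: tent_norm_def)
qed

lemma tent_norm_minus_commute: "tent_norm a q (f - g) = tent_norm a q (g - f)"
proof -
  have "norm (tent_J a q (f - g) x p) = norm (tent_J a q (g - f) x p)" for x p
    by (cases p) (simp add: tent_J_def norm_minus_commute)
  then show ?thesis
    by (simp add: tent_norm_def)
qed

lemma tent_norm_le_add_diff:
  assumes q: "1 \<le> q" and a: "0 \<le> a" and f: "f \<in> Cc_D" and g: "g \<in> Cc_D"
  shows "tent_norm a q f \<le> tent_norm a q g + tent_norm a q (f - g)"
proof -
  have q0: "0 < q"
    using q by simp
  have fg: "f - g \<in> Cc_D"
    by (rule Cc_D_diff[OF f g])
  define U where "U h x p = indicator gauss_D p * norm (tent_J a q h x p)" for h :: "'a \<times> real \<Rightarrow> 'b" and x p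
  have U_powr: "U h x p powr q = indicator gauss_D p *\<^sub>R norm (tent_J a q h x p) powr q" for h x p
    by (simp add: U_def split: split_indicator)
  have slice: "(\<integral>p. U h x p powr q \<partial>upper_measure) = measure (tent_measure q h) (gauss_cone a x)"
    if "h \<in> Cc_D" for h x
    using set_integral_tent_J_powr[OF that q0, of a x] unfolding U_powr set_lebesgue_integral_def .
  have "measure (tent_measure q f) (gauss_cone a x) powr (1 / q)
      \<le> measure (tent_measure q g) (gauss_cone a x) powr (1 / q)
        + measure (tent_measure q (f - g)) (gauss_cone a x) powr (1 / q)" for x
    unfolding slice[OF f, symmetric] slice[OF g, symmetric] slice[OF fg, symmetric]
  proof (rule Minkowski_powr[OF q])
    show "integrable upper_measure (\<lambda>p. U g x p powr q)" "integrable upper_measure (\<lambda>p. U (f - g) x p powr q)"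
      unfolding U_powr by (intro integrable_tent_J_powr f g fg q0)+
    fix p
    show "0 \<le> U g x p" "0 \<le> U (f - g) x p" "0 \<le> U f x p"
      by (auto simp: U_def)
    have "tent_J a q f x p = tent_J a q g x p + tent_J a q (f - g) x p"
      by (cases p) (simp add: tent_J_def flip: scaleR_right_distrib)
    then show "U f x p \<le> U g x p + U (f - g) x p"
      by (simp add: U_def norm_triangle_ineq split: split_indicator)
  qed
  then have "tent_norm a q f \<le> (\<integral>x. measure (tent_measure q g) (gauss_cone a x) powr (1 / q)
        + measure (tent_measure q (f - g)) (gauss_cone a x) powr (1 / q) \<partial>gauss_measure)"
    unfolding tent_norm_eq[OF f q0]
    by (intro integral_mono Bochner_Integration.integrable_add integrable_tent_square_function f g fg q0 a)
  also have "\<dots> = tent_norm a q g + tent_norm a q (f - g)"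
    unfolding tent_norm_eq[OF g q0] tent_norm_eq[OF fg q0]
    by (intro Bochner_Integration.integral_add integrable_tent_square_function f g fg q0 a)
  finally show ?thesis .
qed

lemma abs_tent_norm_diff_le:
  assumes q: "1 \<le> q" and a: "0 \<le> a" and f: "f \<in> Cc_D" and g: "g \<in> Cc_D"
  shows "\<bar>tent_norm a q f - tent_norm a q g\<bar> \<le> tent_norm a q (f - g)"
  using tent_norm_le_add_diff[OF q a f g] tent_norm_le_add_diff[OF q a g f]
    tent_norm_minus_commute[of a q f g] by linarith

section \<open>Comparison of tent norms\<close>

lemma tent_norm_mono_aperture:
  assumes q: "0 < q" and a: "0 \<le> a" and ab: "a \<le> b" and f: "f \<in> Cc_D"
  shows "tent_norm a q f \<le> tent_norm b q f"
proof -
  interpret finite_measure "tent_measure q f"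
    by (rule finite_tent_measure[OF f q])
  have "gauss_cone a x \<subseteq> gauss_cone b x" for x
  proof
    fix p assume p: "p \<in> gauss_cone a x"
    then have "a * snd p \<le> b * snd p"
      using ab by (auto simp: gauss_cone_def mem_gauss_D_iff)
    with p show "p \<in> gauss_cone b x"
      by (auto simp: gauss_cone_def)
  qed
  then show ?thesis
    unfolding tent_norm_eq[OF f q] using q a ab
    by (intro integral_mono integrable_tent_square_function f powr_mono2 finite_measure_mono) auto
qed

lemma tent_norm_change_of_aperture:
  assumes q: "1 < q" and a: "0 < a" and ab: "a \<le> b"
  obtains C where "0 < C"
    "\<And>f :: 'a::euclidean_space \<times> real \<Rightarrow> 'b::real_normed_field.
       f \<in> Cc_D \<Longrightarrow> tent_norm b q f \<le> C * tent_norm a q f"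
proof -
  have r: "0 < 1 / q" "1 / q < 1"
    using q by auto
  obtain C where C: "0 < C" "\<And>M :: ('a \<times> real) measure.
       finite_measure M \<Longrightarrow> sets M = sets borel \<Longrightarrow>
       (\<integral>\<^sup>+x. ennreal (measure M (gauss_cone b x) powr (1 / q)) \<partial>gauss_measure)
       \<le> ennreal C * (\<integral>\<^sup>+x. ennreal (measure M (gauss_cone a x) powr (1 / q)) \<partial>gauss_measure)"
    by (rule cone_change_of_aperture[OF a ab r], rule that, assumption, blast)
  have "tent_norm b q f \<le> C * tent_norm a q f"
    if f: "f \<in> Cc_D" for f :: "'a \<times> real \<Rightarrow> 'b"
  proof -
    have q0: "0 < q"
      using q by simp
    have norm: "(\<integral>\<^sup>+x. ennreal (measure (tent_measure q f) (gauss_cone c x) powr (1 / q)) \<partial>gauss_measure)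
        = ennreal (tent_norm c q f)" if "0 \<le> c" for c
      unfolding tent_norm_eq[OF f q0]
      by (intro nn_integral_eq_integral integrable_tent_square_function f q0 that AE_I2) simp
    have "ennreal (tent_norm b q f) \<le> ennreal C * ennreal (tent_norm a q f)"
      using C(2)[OF finite_tent_measure[OF f q0] sets_tent_measure] a ab norm by simp
    also have "\<dots> = ennreal (C * tent_norm a q f)"
      using C(1) tent_norm_nonneg by (intro ennreal_mult[symmetric]) auto
    finally show ?thesis
      using C(1) tent_norm_nonneg[of a q f] by (simp add: ennreal_le_iff)
  qed
  with C(1) show ?thesis
    by (rule that)
qed

section \<open>Completions for equivalent norms\<close>

lemma cauchy_seqs_mono:
  assumes V: "\<And>u v. u \<in> V \<Longrightarrow> v \<in> V \<Longrightarrow> u - v \<in> V"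
    and C: "0 < C" "\<And>u. u \<in> V \<Longrightarrow> N u \<le> C * N' u"
  shows "cauchy_seqs V N' \<subseteq> cauchy_seqs V N"
proof
  fix u assume u: "u \<in> cauchy_seqs V N'"
  then have uV: "u k \<in> V" for k
    by (auto simp: cauchy_seqs_def)
  have "\<exists>M. \<forall>k\<ge>M. \<forall>l\<ge>M. N (u k - u l) < e" if e: "0 < e" for e
  proof -
    have "0 < e / C"
      using e C(1) by simp
    moreover have "\<forall>e>0. \<exists>M. \<forall>k\<ge>M. \<forall>l\<ge>M. N' (u k - u l) < e"
      using u by (simp add: cauchy_seqs_def)
    ultimately obtain M where "\<forall>k\<ge>M. \<forall>l\<ge>M. N' (u k - u l) < e / C"
      by meson
    then have M: "N' (u k - u l) < e / C" if "k \<ge> M" "l \<ge> M" for k l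
      using that by blast
    have "N (u k - u l) < e" if "k \<ge> M" "l \<ge> M" for k l
    proof -
      have "N (u k - u l) \<le> C * N' (u k - u l)"
        by (intro C(2) V uV)
      also have "\<dots> < e"
        using M[OF that] C(1) by (simp add: pos_less_divide_eq mult.commute)
      finally show ?thesis .
    qed
    then show ?thesis
      by blast
  qed
  with uV show "u \<in> cauchy_seqs V N"
    by (auto simp: cauchy_seqs_def)
qed

lemma cauchy_equiv_mono:
  assumes V: "\<And>u v. u \<in> V \<Longrightarrow> v \<in> V \<Longrightarrow> u - v \<in> V"
    and C: "0 < C" "\<And>u. u \<in> V \<Longrightarrow> N u \<le> C * N' u"
    and nonneg: "\<And>u. 0 \<le> N u"
  shows "cauchy_equiv V N' \<subseteq> cauchy_equiv V N"
proof
  fix z assume z: "z \<in> cauchy_equiv V N'"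
  then obtain u v where uv: "z = (u, v)" "u \<in> cauchy_seqs V N'" "v \<in> cauchy_seqs V N'"
    and lim: "(\<lambda>k. N' (u k - v k)) \<longlonglongrightarrow> 0"
    by (auto simp: cauchy_equiv_def)
  have "u k \<in> V" "v k \<in> V" for k
    using uv by (auto simp: cauchy_seqs_def)
  then have "norm (N (u k - v k)) \<le> C * N' (u k - v k)" for k
    using nonneg by (simp add: C(2) V)
  moreover have "(\<lambda>k. C * N' (u k - v k)) \<longlonglongrightarrow> 0"
    using tendsto_mult_left[OF lim, of C] by simp
  ultimately have "(\<lambda>k. N (u k - v k)) \<longlonglongrightarrow> 0"
    by (rule Lim_null_comparison[OF always_eventually[OF allI]])
  moreover have "cauchy_seqs V N' \<subseteq> cauchy_seqs V N"
    by (rule cauchy_seqs_mono[OF V C])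
  ultimately show "z \<in> cauchy_equiv V N"
    using uv by (auto simp: cauchy_equiv_def)
qed

lemma completion_cong:
  assumes V: "\<And>u v. u \<in> V \<Longrightarrow> v \<in> V \<Longrightarrow> u - v \<in> V"
    and C: "0 < C" "\<And>u. u \<in> V \<Longrightarrow> N u \<le> C * N' u"
    and C': "0 < C'" "\<And>u. u \<in> V \<Longrightarrow> N' u \<le> C' * N u"
    and nonneg: "\<And>u. 0 \<le> N u" "\<And>u. 0 \<le> N' u"
  shows "completion V N = completion V N'"
proof -
  have "cauchy_seqs V N = cauchy_seqs V N'"
    by (intro equalityI cauchy_seqs_mono[OF V C] cauchy_seqs_mono[OF V C'])
  moreover have "cauchy_equiv V N = cauchy_equiv V N'"
    by (intro equalityI cauchy_equiv_mono[OF V C nonneg(1)] cauchy_equiv_mono[OF V C' nonneg(2)])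
  ultimately show ?thesis
    by (simp add: completion_def)
qed

text \<open>
  This is where the definite description in \<open>completion_norm\<close> is shown to denote. By the triangle
  inequality the norms along a Cauchy sequence form a Cauchy sequence of reals, and equivalent
  sequences give the same limit. The class also has to contain a sequence, since otherwise every
  real number would be such a limit.
\<close>

lemma completion_norm_tendsto:
  assumes self: "\<And>u. u \<in> V \<Longrightarrow> N (u - u) = 0"
    and triangle: "\<And>u v. u \<in> V \<Longrightarrow> v \<in> V \<Longrightarrow> \<bar>N u - N v\<bar> \<le> N (u - v)"
    and F: "F \<in> completion V N"
  obtains u where "u \<in> F" "range u \<subseteq> V" "\<And>v. v \<in> F \<Longrightarrow> (\<lambda>k. N (v k)) \<longlonglongrightarrow> completion_norm N F"
proof -
  obtain u where u: "u \<in> cauchy_seqs V N" and F_eq: "F = cauchy_equiv V N `` {u}"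
    using F by (auto simp: completion_def elim: quotientE)
  have uV: "u k \<in> V" for k
    using u by (auto simp: cauchy_seqs_def)
  have uF: "u \<in> F"
    using u self[OF uV] by (simp add: F_eq cauchy_equiv_def)
  have "Cauchy (\<lambda>k. N (u k))"
  proof (rule metric_CauchyI)
    fix e :: real assume "0 < e"
    moreover have "\<forall>e>0. \<exists>M. \<forall>k\<ge>M. \<forall>l\<ge>M. N (u k - u l) < e"
      using u by (simp add: cauchy_seqs_def)
    ultimately obtain M where M: "\<forall>k\<ge>M. \<forall>l\<ge>M. N (u k - u l) < e"
      by meson
    have "dist (N (u k)) (N (u l)) < e" if "k \<ge> M" "l \<ge> M" for k l
      using le_less_trans[OF triangle[OF uV uV]] M that unfolding dist_real_def by blast
    then show "\<exists>M. \<forall>k\<ge>M. \<forall>l\<ge>M. dist (N (u k)) (N (u l)) < e"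
      by blast
  qed
  then obtain L where L: "(\<lambda>k. N (u k)) \<longlonglongrightarrow> L"
    using Cauchy_convergent convergent_def by blast
  have lim: "(\<lambda>k. N (v k)) \<longlonglongrightarrow> L" if v: "v \<in> F" for v
  proof -
    have vV: "v k \<in> V" for k
      using v by (auto simp: F_eq cauchy_equiv_def cauchy_seqs_def)
    have diff: "(\<lambda>k. N (u k - v k)) \<longlonglongrightarrow> 0"
      using v by (simp add: F_eq cauchy_equiv_def)
    have "(\<lambda>k. N (u k) - N (v k)) \<longlonglongrightarrow> 0"
      using triangle[OF uV vV]
      by (intro Lim_null_comparison[OF _ diff] always_eventually) auto
    from tendsto_diff[OF L this] show ?thesis
      by simp
  qed
  have "completion_norm N F = L"
    unfolding completion_norm_def using lim uF LIMSEQ_unique by (intro the_equality) blast+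
  with that[OF uF] uV lim show ?thesis
    by blast
qed

lemma tent_space_norm_tendsto:
  assumes q: "1 \<le> q" and a: "0 \<le> a" and F: "F \<in> (tent_space a q :: (nat \<Rightarrow> 'a::euclidean_space \<times> real \<Rightarrow> 'b::real_normed_field) set set)"
  obtains u where "u \<in> F" "range u \<subseteq> Cc_D"
    "\<And>v. v \<in> F \<Longrightarrow> (\<lambda>k. tent_norm a q (v k)) \<longlonglongrightarrow> tent_space_norm a q F"
proof (rule completion_norm_tendsto[of Cc_D "tent_norm a q" F])
  show "F \<in> completion Cc_D (tent_norm a q)"
    using F by (simp add: tent_space_def)
  show "tent_norm a q (f - f) = 0" for f :: "'a \<times> real \<Rightarrow> 'b"
    using q by (intro tent_norm_diff_self) simp
  show "\<bar>tent_norm a q f - tent_norm a q g\<bar> \<le> tent_norm a q (f - g)"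
    if "f \<in> Cc_D" "g \<in> Cc_D" for f g :: "'a \<times> real \<Rightarrow> 'b"
    by (rule abs_tent_norm_diff_le[OF q a that])
qed (auto simp: tent_space_norm_def intro: that)

theorem theorem3p8:
  fixes q \<alpha>\<^sub>0 \<alpha> :: real
  assumes "1 < q" and "1 < \<alpha>\<^sub>0" and "\<alpha>\<^sub>0 < \<alpha>"
  shows "(tent_space \<alpha> q :: (nat \<Rightarrow> 'a::euclidean_space \<times> real \<Rightarrow> 'b::real_normed_field) set set)
           = tent_space \<alpha>\<^sub>0 q \<and>
         (\<exists>c C. 0 < c \<and> 0 < C \<and>
           (\<forall>F \<in> (tent_space \<alpha> q :: (nat \<Rightarrow> 'a \<times> real \<Rightarrow> 'b) set set).
              c * tent_space_norm \<alpha>\<^sub>0 q F \<le> tent_space_norm \<alpha> q F \<and>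
              tent_space_norm \<alpha> q F \<le> C * tent_space_norm \<alpha>\<^sub>0 q F))"
proof -
  have pos: "0 < q" "1 \<le> q" "0 < \<alpha>\<^sub>0" "0 \<le> \<alpha>\<^sub>0" "0 \<le> \<alpha>" "\<alpha>\<^sub>0 \<le> \<alpha>"
    using assms by auto
  obtain C where C: "0 < C" and upper:
    "\<And>f :: 'a \<times> real \<Rightarrow> 'b. f \<in> Cc_D \<Longrightarrow> tent_norm \<alpha> q f \<le> C * tent_norm \<alpha>\<^sub>0 q f"
    by (rule tent_norm_change_of_aperture[OF assms(1) pos(3,6)], rule that, assumption, blast)
  have lower: "tent_norm \<alpha>\<^sub>0 q f \<le> 1 * tent_norm \<alpha> q f" if "f \<in> Cc_D" for f :: "'a \<times> real \<Rightarrow> 'b"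
    using tent_norm_mono_aperture[OF pos(1,4,6) that] by simp
  have eq: "(tent_space \<alpha> q :: (nat \<Rightarrow> 'a \<times> real \<Rightarrow> 'b) set set) = tent_space \<alpha>\<^sub>0 q"
    unfolding tent_space_def
    by (rule completion_cong[OF Cc_D_diff C upper zero_less_one lower tent_norm_nonneg tent_norm_nonneg])
  have "1 * tent_space_norm \<alpha>\<^sub>0 q F \<le> tent_space_norm \<alpha> q F \<and>
      tent_space_norm \<alpha> q F \<le> C * tent_space_norm \<alpha>\<^sub>0 q F"
    if F: "F \<in> (tent_space \<alpha> q :: (nat \<Rightarrow> 'a \<times> real \<Rightarrow> 'b) set set)" for F
  proof -
    obtain u where u: "u \<in> F" "range u \<subseteq> Cc_D"
      and lim: "\<And>v. v \<in> F \<Longrightarrow> (\<lambda>k. tent_norm \<alpha> q (v k)) \<longlonglongrightarrow> tent_space_norm \<alpha> q F"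
      by (rule tent_space_norm_tendsto[OF pos(2,5) F], rule that, assumption, assumption, blast)
    have F0: "F \<in> tent_space \<alpha>\<^sub>0 q"
      using F eq by simp
    obtain u' where lim0: "\<And>v. v \<in> F \<Longrightarrow> (\<lambda>k. tent_norm \<alpha>\<^sub>0 q (v k)) \<longlonglongrightarrow> tent_space_norm \<alpha>\<^sub>0 q F"
      by (rule tent_space_norm_tendsto[OF pos(2,4) F0], rule that, blast)
    have uV: "u k \<in> Cc_D" for k
      using u(2) by auto
    show ?thesis
    proof
      show "1 * tent_space_norm \<alpha>\<^sub>0 q F \<le> tent_space_norm \<alpha> q F"
        using lower[OF uV] by (intro LIMSEQ_le[OF tendsto_mult_left[OF lim0[OF u(1)]] lim[OF u(1)]]) auto
      show "tent_space_norm \<alpha> q F \<le> C * tent_space_norm \<alpha>\<^sub>0 q F"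
        using upper[OF uV] by (intro LIMSEQ_le[OF lim[OF u(1)] tendsto_mult_left[OF lim0[OF u(1)]]]) auto
    qed
  qed
  with eq C show ?thesis
    by (intro conjI exI[of _ 1] exI[of _ C]) auto
qed

end
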